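(* (a) Let $P\colon\mathcal E\to\mathcal B$ be a Grothendieck fibration and $K$ a covering function on $\mathcal B$ (so that $P\colon\mathcal E\to(\mathcal B,K)$ is a fibred site). Then $P\colon(\mathcal E,K_P)\to(\mathcal B,K)$ is an internal fibration in $\mathit{SITE}_s$, where $K_P$ is the covering function on $\mathcal E$ induced by $P$ and $K$. (b) Conversely, let $P\colon(\mathcal E,K_{\mathcal E})\to(\mathcal B,K_{\mathcal B})$ be an internal fibration in $\mathit{SITE}_s$. If both $K_{\mathcal B}$ and $K_{\mathcal E}$ satisfy axiom $(\tilde{\mathrm M}')$, then $P\colon\mathcal E\to\mathcal B$ is a Grothendieck fibration. If moreover $K_{\mathcal E}$ satisfies axioms $(\tilde{\mathrm M})$ and $(\mathrm L)$, then $K_P\preceq K_{\mathcal E}$, where $K_P$ is the covering function on $\mathcal E$ induced by $P$ and $K_{\mathcal B}$.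
   Context: A covering of an object $C$ of a category is a class of arrows with codomain $C$. A covering function $K$ on $\mathcal C$ assigns to each object $C$ a collection $K(C)$ of coverings of $C$; a site $(\mathcal C,K)$ is a category with a covering function. A covering $R$ of $C$ refines a covering $S$ of $C$ if each arrow of $R$ factors through an arrow of $S$. $K'\preceq K$ means that each $K'$-covering admits a refinement belonging to $K$. Axioms on $K$: $(\tilde{\mathrm M})$ for every isomorphism $f\colon D\to C$, $\{f\}\in K(C)$. $(\tilde{\mathrm M}')$ for every object $C$, $\{1_C\}\in K(C)$. $(\mathrm L)$ given a $K$-covering $R$ and, for each $f\in R$, a $K$-covering $R_f$ of $\mathrm{dom} f$, there is a $K$-covering refining $\{f\circ g\mid f\in R,\ g\in R_f\}$. $\mathit{SITE}_s$ is the 2-category of (possibly large) sites, strict morphisms of sites (functors $F\colon\mathcal C\to\mathcal D$ such that $F(R)=\{F(f)\mid f\in R\}$ is a covering of the target site for every covering $R$ of the source site), and all natural transformations between these. Induced covering function: for a functor $P\colon\mathcal E\to\mathcal B$ that is a fibration and a covering function $K$ on $\mathcal B$, the coverings in $K_P(E)$ are the families $\{f_i^*E\to E\mid i\in I\}$ of Cartesian arrows over arrows $f_i$ such that $\{f_i\mid i\in I\}$ is a $K$-covering of $P(E)$ (the indexing need not be injective; the covering is the class of arrows in the family). A morphism $p\colon E\to B$ of a 2-category $\mathbb A$ is an internal fibration if (i) for every object $X$ of $\mathbb A$ the functor $p_*\colon\mathbb A(X,E)\to\mathbb A(X,B)$ given by postcomposition is a Grothendieck fibration, and (ii) for every morphism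 $f\colon X\to Y$ of $\mathbb A$, the square formed by the precomposition functors $f^*\colon\mathbb A(Y,E)\to\mathbb A(X,E)$ and $f^*\colon\mathbb A(Y,B)\to\mathbb A(X,B)$ and the functors $p_*$ is a Cartesian morphism of fibrations, i.e. $f^*\colon\mathbb A(Y,E)\to\mathbb A(X,E)$ sends $p_*$-Cartesian arrows to $p_*$-Cartesian arrows.
   Formalization: The last clause fails for empty coverings; it is proved that every nonempty K_P-covering is refined by a K_E-covering, and that K_P ⪯ K_E in full if, for every object E, the empty covering is in K_E(E) whenever it is in K_B(P(E)). *)

theory Defs
  imports "HOL-Library.FuncSet" "HOL-Library.Infinite_Typeclass"
begin

section \<open>Categories, functors, Grothendieck fibrations\<close>

text \<open>
  Objects and arrows of a category are carved out of two types by carrier sets; the operations are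
  unconstrained outside the carriers. \<^term>\<open>cmp C g f\<close> is ``g after f''.
\<close>

record ('o, 'a) category =
  Obj :: "'o set"
  Arr :: "'a set"
  src :: "'a \<Rightarrow> 'o"
  tgt :: "'a \<Rightarrow> 'o"
  ident :: "'o \<Rightarrow> 'a"
  cmp :: "'a \<Rightarrow> 'a \<Rightarrow> 'a"

locale category =
  fixes C :: "('o, 'a) category"
  assumes src_Obj: "f \<in> Arr C \<Longrightarrow> src C f \<in> Obj C"
    and tgt_Obj: "f \<in> Arr C \<Longrightarrow> tgt C f \<in> Obj C"
    and ident_Arr: "c \<in> Obj C \<Longrightarrow> ident C c \<in> Arr C"
    and src_ident: "c \<in> Obj C \<Longrightarrow> src C (ident C c) = c"
    and tgt_ident: "c \<in> Obj C \<Longrightarrow> tgt C (ident C c) = c"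
    and cmp_Arr: "\<lbrakk>f \<in> Arr C; g \<in> Arr C; src C g = tgt C f\<rbrakk> \<Longrightarrow> cmp C g f \<in> Arr C"
    and src_cmp: "\<lbrakk>f \<in> Arr C; g \<in> Arr C; src C g = tgt C f\<rbrakk> \<Longrightarrow> src C (cmp C g f) = src C f"
    and tgt_cmp: "\<lbrakk>f \<in> Arr C; g \<in> Arr C; src C g = tgt C f\<rbrakk> \<Longrightarrow> tgt C (cmp C g f) = tgt C g"
    and cmp_ident_right: "f \<in> Arr C \<Longrightarrow> cmp C f (ident C (src C f)) = f"
    and cmp_ident_left: "f \<in> Arr C \<Longrightarrow> cmp C (ident C (tgt C f)) f = f"
    and cmp_assoc: "\<lbrakk>f \<in> Arr C; g \<in> Arr C; h \<in> Arr C; src C g = tgt C f; src C h = tgt C g\<rbrakk>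
      \<Longrightarrow> cmp C h (cmp C g f) = cmp C (cmp C h g) f"

definition is_iso :: "('o, 'a) category \<Rightarrow> 'a \<Rightarrow> bool" where
  "is_iso C f \<longleftrightarrow> f \<in> Arr C \<and>
     (\<exists>g\<in>Arr C. src C g = tgt C f \<and> tgt C g = src C f \<and>
        cmp C g f = ident C (src C f) \<and> cmp C f g = ident C (tgt C f))"

record ('o, 'a, 'p, 'b) func =
  on_ob :: "'o \<Rightarrow> 'p"
  on_ar :: "'a \<Rightarrow> 'b"

text \<open>
  Extensionality makes equality of records coincide with equality of functors.
\<close>

definition is_functor ::
  "('o, 'a) category \<Rightarrow> ('p, 'b) category \<Rightarrow> ('o, 'a, 'p, 'b) func \<Rightarrow> bool" where
  "is_functor C D F \<longleftrightarrow>
     on_ob F \<in> Obj C \<rightarrow>\<^sub>E Obj D \<and> on_ar F \<in> Arr C \<rightarrow>\<^sub>E Arr D \<and>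
     (\<forall>f\<in>Arr C. src D (on_ar F f) = on_ob F (src C f) \<and> tgt D (on_ar F f) = on_ob F (tgt C f)) \<and>
     (\<forall>c\<in>Obj C. on_ar F (ident C c) = ident D (on_ob F c)) \<and>
     (\<forall>f\<in>Arr C. \<forall>g\<in>Arr C. src C g = tgt C f \<longrightarrow>
        on_ar F (cmp C g f) = cmp D (on_ar F g) (on_ar F f))"

definition cartesian ::
  "('e, 'a) category \<Rightarrow> ('p, 'b) category \<Rightarrow> ('e, 'a, 'p, 'b) func \<Rightarrow> 'a \<Rightarrow> bool" where
  "cartesian E B P \<phi> \<longleftrightarrow> \<phi> \<in> Arr E \<and>
     (\<forall>\<psi>\<in>Arr E. \<forall>g\<in>Arr B.
        tgt E \<psi> = tgt E \<phi> \<and> src B g = on_ob P (src E \<psi>) \<and> tgt B g = on_ob P (src E \<phi>) \<and>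
        cmp B (on_ar P \<phi>) g = on_ar P \<psi> \<longrightarrow>
        (\<exists>!\<chi>. \<chi> \<in> Arr E \<and> src E \<chi> = src E \<psi> \<and> tgt E \<chi> = src E \<phi> \<and>
           on_ar P \<chi> = g \<and> cmp E \<phi> \<chi> = \<psi>))"

definition grothendieck_fibration ::
  "('e, 'a) category \<Rightarrow> ('p, 'b) category \<Rightarrow> ('e, 'a, 'p, 'b) func \<Rightarrow> bool" where
  "grothendieck_fibration E B P \<longleftrightarrow> category E \<and> category B \<and> is_functor E B P \<and>
     (\<forall>e\<in>Obj E. \<forall>f\<in>Arr B. tgt B f = on_ob P e \<longrightarrow>
        (\<exists>\<phi>. cartesian E B P \<phi> \<and> tgt E \<phi> = e \<and> on_ar P \<phi> = f))"


section \<open>2-categories and internal fibrations\<close>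

record ('o, 'm, 'c) two_category =
  Obj2 :: "'o set"
  Hom2 :: "'o \<Rightarrow> 'o \<Rightarrow> ('m, 'c) category"
  unit1 :: "'o \<Rightarrow> 'm"
  comp1 :: "'o \<Rightarrow> 'o \<Rightarrow> 'o \<Rightarrow> 'm \<Rightarrow> 'm \<Rightarrow> 'm"
  hcomp :: "'o \<Rightarrow> 'o \<Rightarrow> 'o \<Rightarrow> 'c \<Rightarrow> 'c \<Rightarrow> 'c"

text \<open>
  A 2-category is given as a category enriched in categories: \<^term>\<open>comp1 A X Y Z\<close> and
  \<^term>\<open>hcomp A X Y Z\<close> are the object and arrow parts of the composition functor
  from the product of \<^term>\<open>Hom2 A Y Z\<close> and \<^term>\<open>Hom2 A X Y\<close> to \<^term>\<open>Hom2 A X Z\<close>.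
\<close>

locale two_category =
  fixes A :: "('o, 'm, 'c) two_category"
  assumes category_Hom2: "\<lbrakk>X \<in> Obj2 A; Y \<in> Obj2 A\<rbrakk> \<Longrightarrow> category (Hom2 A X Y)"
    and unit1_Obj: "X \<in> Obj2 A \<Longrightarrow> unit1 A X \<in> Obj (Hom2 A X X)"
    and comp1_Obj: "\<lbrakk>X \<in> Obj2 A; Y \<in> Obj2 A; Z \<in> Obj2 A;
        f \<in> Obj (Hom2 A X Y); g \<in> Obj (Hom2 A Y Z)\<rbrakk> \<Longrightarrow> comp1 A X Y Z g f \<in> Obj (Hom2 A X Z)"
    and hcomp_Arr: "\<lbrakk>X \<in> Obj2 A; Y \<in> Obj2 A; Z \<in> Obj2 A;
        \<alpha> \<in> Arr (Hom2 A X Y); \<beta> \<in> Arr (Hom2 A Y Z)\<rbrakk> \<Longrightarrow>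
        hcomp A X Y Z \<beta> \<alpha> \<in> Arr (Hom2 A X Z) \<and>
        src (Hom2 A X Z) (hcomp A X Y Z \<beta> \<alpha>) =
          comp1 A X Y Z (src (Hom2 A Y Z) \<beta>) (src (Hom2 A X Y) \<alpha>) \<and>
        tgt (Hom2 A X Z) (hcomp A X Y Z \<beta> \<alpha>) =
          comp1 A X Y Z (tgt (Hom2 A Y Z) \<beta>) (tgt (Hom2 A X Y) \<alpha>)"
    and hcomp_ident: "\<lbrakk>X \<in> Obj2 A; Y \<in> Obj2 A; Z \<in> Obj2 A;
        f \<in> Obj (Hom2 A X Y); g \<in> Obj (Hom2 A Y Z)\<rbrakk> \<Longrightarrow>
        hcomp A X Y Z (ident (Hom2 A Y Z) g) (ident (Hom2 A X Y) f) =
          ident (Hom2 A X Z) (comp1 A X Y Z g f)"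
    and interchange: "\<lbrakk>X \<in> Obj2 A; Y \<in> Obj2 A; Z \<in> Obj2 A;
        \<alpha> \<in> Arr (Hom2 A X Y); \<alpha>' \<in> Arr (Hom2 A X Y); src (Hom2 A X Y) \<alpha>' = tgt (Hom2 A X Y) \<alpha>;
        \<beta> \<in> Arr (Hom2 A Y Z); \<beta>' \<in> Arr (Hom2 A Y Z); src (Hom2 A Y Z) \<beta>' = tgt (Hom2 A Y Z) \<beta>\<rbrakk> \<Longrightarrow>
        hcomp A X Y Z (cmp (Hom2 A Y Z) \<beta>' \<beta>) (cmp (Hom2 A X Y) \<alpha>' \<alpha>) =
          cmp (Hom2 A X Z) (hcomp A X Y Z \<beta>' \<alpha>') (hcomp A X Y Z \<beta> \<alpha>)"
    and comp1_assoc: "\<lbrakk>W \<in> Obj2 A; X \<in> Obj2 A; Y \<in> Obj2 A; Z \<in> Obj2 A;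
        f \<in> Obj (Hom2 A W X); g \<in> Obj (Hom2 A X Y); h \<in> Obj (Hom2 A Y Z)\<rbrakk> \<Longrightarrow>
        comp1 A W Y Z h (comp1 A W X Y g f) = comp1 A W X Z (comp1 A X Y Z h g) f"
    and hcomp_assoc: "\<lbrakk>W \<in> Obj2 A; X \<in> Obj2 A; Y \<in> Obj2 A; Z \<in> Obj2 A;
        \<alpha> \<in> Arr (Hom2 A W X); \<beta> \<in> Arr (Hom2 A X Y); \<gamma> \<in> Arr (Hom2 A Y Z)\<rbrakk> \<Longrightarrow>
        hcomp A W Y Z \<gamma> (hcomp A W X Y \<beta> \<alpha>) = hcomp A W X Z (hcomp A X Y Z \<gamma> \<beta>) \<alpha>"
    and comp1_unit: "\<lbrakk>X \<in> Obj2 A; Y \<in> Obj2 A; f \<in> Obj (Hom2 A X Y)\<rbrakk> \<Longrightarrow>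
        comp1 A X X Y f (unit1 A X) = f \<and> comp1 A X Y Y (unit1 A Y) f = f"
    and hcomp_unit: "\<lbrakk>X \<in> Obj2 A; Y \<in> Obj2 A; \<alpha> \<in> Arr (Hom2 A X Y)\<rbrakk> \<Longrightarrow>
        hcomp A X X Y \<alpha> (ident (Hom2 A X X) (unit1 A X)) = \<alpha> \<and>
        hcomp A X Y Y (ident (Hom2 A Y Y) (unit1 A Y)) \<alpha> = \<alpha>"

definition postcomp ::
  "('o, 'm, 'c) two_category \<Rightarrow> 'o \<Rightarrow> 'o \<Rightarrow> 'o \<Rightarrow> 'm \<Rightarrow> ('m, 'c, 'm, 'c) func" where
  "postcomp A X E B p =
     \<lparr>on_ob = (\<lambda>g\<in>Obj (Hom2 A X E). comp1 A X E B p g),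
      on_ar = (\<lambda>\<alpha>\<in>Arr (Hom2 A X E). hcomp A X E B (ident (Hom2 A E B) p) \<alpha>)\<rparr>"

definition precomp ::
  "('o, 'm, 'c) two_category \<Rightarrow> 'o \<Rightarrow> 'o \<Rightarrow> 'o \<Rightarrow> 'm \<Rightarrow> ('m, 'c, 'm, 'c) func" where
  "precomp A X Y E f =
     \<lparr>on_ob = (\<lambda>g\<in>Obj (Hom2 A Y E). comp1 A X Y E g f),
      on_ar = (\<lambda>\<alpha>\<in>Arr (Hom2 A Y E). hcomp A X Y E \<alpha> (ident (Hom2 A X Y) f))\<rparr>"

definition internal_fibration :: "('o, 'm, 'c) two_category \<Rightarrow> 'o \<Rightarrow> 'o \<Rightarrow> 'm \<Rightarrow> bool" where
  "internal_fibration A E B p \<longleftrightarrow>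
     E \<in> Obj2 A \<and> B \<in> Obj2 A \<and> p \<in> Obj (Hom2 A E B) \<and>
     (\<forall>X\<in>Obj2 A. grothendieck_fibration (Hom2 A X E) (Hom2 A X B) (postcomp A X E B p)) \<and>
     (\<forall>X\<in>Obj2 A. \<forall>Y\<in>Obj2 A. \<forall>f\<in>Obj (Hom2 A X Y). \<forall>\<phi>.
        cartesian (Hom2 A Y E) (Hom2 A Y B) (postcomp A Y E B p) \<phi> \<longrightarrow>
        cartesian (Hom2 A X E) (Hom2 A X B) (postcomp A X E B p) (on_ar (precomp A X Y E f) \<phi>))"


section \<open>Sites\<close>

text \<open>
  A covering function is only looked at on the objects of its category.
\<close>

type_synonym ('o, 'a) covfun = "'o \<Rightarrow> 'a set set"
type_synonym ('o, 'a) site = "('o, 'a) category \<times> ('o, 'a) covfun"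

definition is_covering :: "('o, 'a) category \<Rightarrow> 'o \<Rightarrow> 'a set \<Rightarrow> bool" where
  "is_covering C c R \<longleftrightarrow> R \<subseteq> {f \<in> Arr C. tgt C f = c}"

definition covering_function :: "('o, 'a) category \<Rightarrow> ('o, 'a) covfun \<Rightarrow> bool" where
  "covering_function C K \<longleftrightarrow> (\<forall>c\<in>Obj C. \<forall>R\<in>K c. is_covering C c R)"

definition is_site :: "('o, 'a) site \<Rightarrow> bool" where
  "is_site = (\<lambda>(C, K). category C \<and> covering_function C K)"

definition refines :: "('o, 'a) category \<Rightarrow> 'a set \<Rightarrow> 'a set \<Rightarrow> bool" where
  "refines C R S \<longleftrightarrow>
     (\<forall>f\<in>R. \<exists>g\<in>S. \<exists>h\<in>Arr C. src C h = src C f \<and> tgt C h = src C g \<and> f = cmp C g h)"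

definition cov_preceq ::
  "('o, 'a) category \<Rightarrow> ('o, 'a) covfun \<Rightarrow> ('o, 'a) covfun \<Rightarrow> bool" where
  "cov_preceq C K' K \<longleftrightarrow> (\<forall>c\<in>Obj C. \<forall>S\<in>K' c. \<exists>R\<in>K c. refines C R S)"

definition axiom_M :: "('o, 'a) category \<Rightarrow> ('o, 'a) covfun \<Rightarrow> bool" where
  "axiom_M C K \<longleftrightarrow> (\<forall>f. is_iso C f \<longrightarrow> {f} \<in> K (tgt C f))"

definition axiom_M' :: "('o, 'a) category \<Rightarrow> ('o, 'a) covfun \<Rightarrow> bool" where
  "axiom_M' C K \<longleftrightarrow> (\<forall>c\<in>Obj C. {ident C c} \<in> K c)"

definition axiom_L :: "('o, 'a) category \<Rightarrow> ('o, 'a) covfun \<Rightarrow> bool" where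
  "axiom_L C K \<longleftrightarrow>
     (\<forall>c\<in>Obj C. \<forall>R\<in>K c. \<forall>S. (\<forall>f\<in>R. S f \<in> K (src C f)) \<longrightarrow>
        (\<exists>T\<in>K c. refines C T {cmp C f g | f g. f \<in> R \<and> g \<in> S f}))"

definition strict_morphism ::
  "('o, 'a) site \<Rightarrow> ('p, 'b) site \<Rightarrow> ('o, 'a, 'p, 'b) func \<Rightarrow> bool" where
  "strict_morphism = (\<lambda>(C, K) (D, L) F. is_functor C D F \<and>
     (\<forall>c\<in>Obj C. \<forall>R\<in>K c. on_ar F ` R \<in> L (on_ob F c)))"

text \<open>
  A set of arrows is the underlying class of some family of Cartesian arrows \<open>f\<^sub>i\<^sup>*e \<rightarrow> e\<close> over a
  covering \<open>{f\<^sub>i | i \<in> I}\<close> iff, indexed by itself, it is such a family. No cleavage is fixed, and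
  several members may lie over the same arrow.
\<close>

definition induced_covfun ::
  "('e, 'a) category \<Rightarrow> ('p, 'b) category \<Rightarrow> ('e, 'a, 'p, 'b) func \<Rightarrow> ('p, 'b) covfun \<Rightarrow>
   ('e, 'a) covfun" where
  "induced_covfun E B P K e =
     {S. (\<forall>\<phi>\<in>S. cartesian E B P \<phi> \<and> tgt E \<phi> = e) \<and> on_ar P ` S \<in> K (on_ob P e)}"


section \<open>The 2-category of sites, strict morphisms and natural transformations\<close>

record ('o, 'a, 'p, 'b) nat_trans =
  nt_src :: "('o, 'a, 'p, 'b) func"
  nt_tgt :: "('o, 'a, 'p, 'b) func"
  component :: "'o \<Rightarrow> 'b"

definition natural ::
  "('o, 'a) category \<Rightarrow> ('p, 'b) category \<Rightarrow> ('o, 'a, 'p, 'b) nat_trans \<Rightarrow> bool" where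
  "natural C D \<alpha> \<longleftrightarrow>
     is_functor C D (nt_src \<alpha>) \<and> is_functor C D (nt_tgt \<alpha>) \<and>
     component \<alpha> \<in> Obj C \<rightarrow>\<^sub>E Arr D \<and>
     (\<forall>c\<in>Obj C. src D (component \<alpha> c) = on_ob (nt_src \<alpha>) c \<and>
        tgt D (component \<alpha> c) = on_ob (nt_tgt \<alpha>) c) \<and>
     (\<forall>f\<in>Arr C. cmp D (component \<alpha> (tgt C f)) (on_ar (nt_src \<alpha>) f) =
        cmp D (on_ar (nt_tgt \<alpha>) f) (component \<alpha> (src C f)))"

definition site_hom ::
  "('o, 'a) site \<Rightarrow> ('p, 'b) site \<Rightarrow>
   (('o, 'a, 'p, 'b) func, ('o, 'a, 'p, 'b) nat_trans) category" where
  "site_hom X Y =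
     \<lparr>Obj = {F. strict_morphism X Y F},
      Arr = {\<alpha>. natural (fst X) (fst Y) \<alpha> \<and>
               strict_morphism X Y (nt_src \<alpha>) \<and> strict_morphism X Y (nt_tgt \<alpha>)},
      src = nt_src,
      tgt = nt_tgt,
      ident = (\<lambda>F. \<lparr>nt_src = F, nt_tgt = F,
                   component = (\<lambda>c\<in>Obj (fst X). ident (fst Y) (on_ob F c))\<rparr>),
      cmp = (\<lambda>\<beta> \<alpha>. \<lparr>nt_src = nt_src \<alpha>, nt_tgt = nt_tgt \<beta>,
                   component = (\<lambda>c\<in>Obj (fst X). cmp (fst Y) (component \<beta> c) (component \<alpha> c))\<rparr>)\<rparr>"

definition func_id :: "('o, 'a) category \<Rightarrow> ('o, 'a, 'o, 'a) func" where
  "func_id C = \<lparr>on_ob = (\<lambda>c\<in>Obj C. c), on_ar = (\<lambda>f\<in>Arr C. f)\<rparr>"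

definition func_comp ::
  "('o, 'a) category \<Rightarrow> ('p, 'b, 'q, 'd) func \<Rightarrow> ('o, 'a, 'p, 'b) func \<Rightarrow> ('o, 'a, 'q, 'd) func" where
  "func_comp C G F =
     \<lparr>on_ob = compose (Obj C) (on_ob G) (on_ob F), on_ar = compose (Arr C) (on_ar G) (on_ar F)\<rparr>"

text \<open>
  All sites whose objects and arrows are elements of the given types; these types play the role
  of the universe in which (possibly large) sites live.
\<close>

definition SITEs ::
  "(('o, 'a) site, ('o, 'a, 'o, 'a) func, ('o, 'a, 'o, 'a) nat_trans) two_category" where
  "SITEs =
     \<lparr>Obj2 = {X. is_site X},
      Hom2 = site_hom,
      unit1 = (\<lambda>X. func_id (fst X)),
      comp1 = (\<lambda>X Y Z. func_comp (fst X)),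
      hcomp = (\<lambda>X Y Z \<beta> \<alpha>.
        \<lparr>nt_src = func_comp (fst X) (nt_src \<beta>) (nt_src \<alpha>),
         nt_tgt = func_comp (fst X) (nt_tgt \<beta>) (nt_tgt \<alpha>),
         component = (\<lambda>c\<in>Obj (fst X). cmp (fst Z) (component \<beta> (on_ob (nt_tgt \<alpha>) c))
                                         (on_ar (nt_src \<beta>) (component \<alpha> c)))\<rparr>)\<rparr>"

lemma is_functorD:
  assumes "is_functor C D F"
  shows "c \<in> Obj C \<Longrightarrow> on_ob F c \<in> Obj D"
    and "f \<in> Arr C \<Longrightarrow> on_ar F f \<in> Arr D"
    and "f \<in> Arr C \<Longrightarrow> src D (on_ar F f) = on_ob F (src C f)"
    and "f \<in> Arr C \<Longrightarrow> tgt D (on_ar F f) = on_ob F (tgt C f)"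
    and "c \<in> Obj C \<Longrightarrow> on_ar F (ident C c) = ident D (on_ob F c)"
    and "\<lbrakk>f \<in> Arr C; g \<in> Arr C; src C g = tgt C f\<rbrakk> \<Longrightarrow>
      on_ar F (cmp C g f) = cmp D (on_ar F g) (on_ar F f)"
    and "on_ob F \<in> extensional (Obj C)"
    and "on_ar F \<in> extensional (Arr C)"
  using assms unfolding is_functor_def by (auto simp: PiE_iff)

lemma is_functor_comp:
  assumes "category C" "is_functor C D F" "is_functor D E G"
  shows "is_functor C E (func_comp C G F)"
proof -
  interpret C: category C by fact
  note [simp] = is_functorD[OF assms(2)] is_functorD[OF assms(3)]
    C.src_Obj C.tgt_Obj C.ident_Arr C.cmp_Arr
  show ?thesis
    unfolding is_functor_def func_comp_def by (auto simp: compose_def)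
qed

lemma is_functor_id: "category C \<Longrightarrow> is_functor C C (func_id C)"
  unfolding is_functor_def func_id_def
  by (auto simp: category.src_Obj category.tgt_Obj category.ident_Arr category.cmp_Arr)

lemma strict_morphism_functor: "strict_morphism X Y F \<Longrightarrow> is_functor (fst X) (fst Y) F"
  by (cases X; cases Y) (auto simp: strict_morphism_def)

lemma strict_morphism_comp:
  assumes "is_site X" "strict_morphism X Y F" "strict_morphism Y Z G"
  shows "strict_morphism X Z (func_comp (fst X) G F)"
proof -
  obtain C K D L E M where XYZ: "X = (C, K)" "Y = (D, L)" "Z = (E, M)"
    by (cases X; cases Y; cases Z)
  have fF: "is_functor C D F" and fG: "is_functor D E G"
    and cC: "category C" and K: "covering_function C K"
    using assms by (auto simp: XYZ strict_morphism_def is_site_def)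
  have "on_ar (func_comp C G F) ` R \<in> M (on_ob (func_comp C G F) c)" if "c \<in> Obj C" "R \<in> K c" for c R
  proof -
    have "R \<subseteq> Arr C"
      using K that by (auto simp: covering_function_def is_covering_def)
    then have "on_ar (func_comp C G F) ` R = on_ar G ` on_ar F ` R"
      by (force simp: func_comp_def compose_def)
    moreover have "on_ar F ` R \<in> L (on_ob F c)"
      using assms(2) that by (auto simp: XYZ strict_morphism_def)
    moreover have "on_ob F c \<in> Obj D"
      using is_functorD(1)[OF fF] that by simp
    ultimately show ?thesis
      using assms(3) that by (auto simp: XYZ strict_morphism_def func_comp_def compose_def)
  qed
  then show ?thesis
    using is_functor_comp[OF cC fF fG] by (auto simp: XYZ strict_morphism_def)
qed

lemma strict_morphism_id:
  assumes "is_site X"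
  shows "strict_morphism X X (func_id (fst X))"
proof -
  obtain C K where X: "X = (C, K)" by (cases X)
  have cC: "category C" and K: "covering_function C K"
    using assms by (auto simp: X is_site_def)
  have "on_ar (func_id C) ` R = R" if "c \<in> Obj C" "R \<in> K c" for c R
    using K that by (force simp: covering_function_def is_covering_def func_id_def)
  then show ?thesis
    using is_functor_id[OF cC] by (auto simp: X strict_morphism_def func_id_def)
qed

lemma naturalD:
  assumes "natural C D \<alpha>"
  shows "is_functor C D (nt_src \<alpha>)" "is_functor C D (nt_tgt \<alpha>)"
    and "c \<in> Obj C \<Longrightarrow> component \<alpha> c \<in> Arr D"
    and "c \<in> Obj C \<Longrightarrow> src D (component \<alpha> c) = on_ob (nt_src \<alpha>) c"
    and "c \<in> Obj C \<Longrightarrow> tgt D (component \<alpha> c) = on_ob (nt_tgt \<alpha>) c"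
    and "f \<in> Arr C \<Longrightarrow> cmp D (component \<alpha> (tgt C f)) (on_ar (nt_src \<alpha>) f) =
        cmp D (on_ar (nt_tgt \<alpha>) f) (component \<alpha> (src C f))"
    and "component \<alpha> \<in> extensional (Obj C)"
  using assms unfolding natural_def by (auto simp: PiE_iff)

lemma natural_ident:
  assumes "category C" "category D" "is_functor C D F"
  shows "natural C D \<lparr>nt_src = F, nt_tgt = F, component = (\<lambda>c\<in>Obj C. ident D (on_ob F c))\<rparr>"
proof -
  interpret C: category C by fact
  interpret D: category D by fact
  note [simp] = is_functorD[OF assms(3)] C.src_Obj C.tgt_Obj D.ident_Arr D.src_ident D.tgt_ident
  have "cmp D (ident D (on_ob F (tgt C f))) (on_ar F f) =
      cmp D (on_ar F f) (ident D (on_ob F (src C f)))" if "f \<in> Arr C" for f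
    using D.cmp_ident_left[of "on_ar F f"] D.cmp_ident_right[of "on_ar F f"] that by simp
  then show ?thesis using assms(3) by (auto simp: natural_def)
qed

lemma natural_vcomp:
  assumes "category C" "category D" "natural C D \<alpha>" "natural C D \<beta>" "nt_src \<beta> = nt_tgt \<alpha>"
  shows "natural C D \<lparr>nt_src = nt_src \<alpha>, nt_tgt = nt_tgt \<beta>,
    component = (\<lambda>c\<in>Obj C. cmp D (component \<beta> c) (component \<alpha> c))\<rparr>"
proof -
  interpret C: category C by fact
  interpret D: category D by fact
  note a = naturalD[OF assms(3)] and b = naturalD[OF assms(4)]
  note fs = is_functorD[OF a(1)] is_functorD[OF a(2)] is_functorD[OF b(2)]
  note [simp] = a(3-5) b(3-5) assms(5) fs C.src_Obj C.tgt_Obj D.cmp_Arr D.src_cmp D.tgt_cmp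
  have "cmp D (cmp D (component \<beta> (tgt C f)) (component \<alpha> (tgt C f))) (on_ar (nt_src \<alpha>) f) =
      cmp D (on_ar (nt_tgt \<beta>) f) (cmp D (component \<beta> (src C f)) (component \<alpha> (src C f)))"
    if "f \<in> Arr C" for f
  proof -
    have "cmp D (cmp D (component \<beta> (tgt C f)) (component \<alpha> (tgt C f))) (on_ar (nt_src \<alpha>) f) =
        cmp D (component \<beta> (tgt C f)) (cmp D (on_ar (nt_tgt \<alpha>) f) (component \<alpha> (src C f)))"
      using that by (simp flip: D.cmp_assoc add: a(6))
    also have "\<dots> = cmp D (cmp D (on_ar (nt_tgt \<beta>) f) (component \<beta> (src C f))) (component \<alpha> (src C f))"
      using that b(6)[OF that] by (simp add: D.cmp_assoc)
    finally show ?thesis using that by (simp add: D.cmp_assoc)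
  qed
  then show ?thesis using a(1) b(2) by (auto simp: natural_def)
qed

lemma natural_hcomp:
  assumes "category C" "category D" "category E" "natural C D \<alpha>" "natural D E \<beta>"
  shows "natural C E \<lparr>nt_src = func_comp C (nt_src \<beta>) (nt_src \<alpha>),
    nt_tgt = func_comp C (nt_tgt \<beta>) (nt_tgt \<alpha>),
    component = (\<lambda>c\<in>Obj C. cmp E (component \<beta> (on_ob (nt_tgt \<alpha>) c))
                               (on_ar (nt_src \<beta>) (component \<alpha> c)))\<rparr>"
proof -
  interpret C: category C by fact
  interpret D: category D by fact
  interpret E: category E by fact
  note a = naturalD[OF assms(4)] and b = naturalD[OF assms(5)]
  note fs = is_functorD(1-4)[OF a(1)] is_functorD(1-4)[OF a(2)] is_functorD(1-4)[OF b(1)] is_functorD(1-4)[OF b(2)]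
  note [simp] = a(3-5) b(3-5) fs C.src_Obj C.tgt_Obj D.cmp_Arr D.src_cmp D.tgt_cmp
    E.cmp_Arr E.src_cmp E.tgt_cmp compose_def
  have "cmp E (cmp E (component \<beta> (on_ob (nt_tgt \<alpha>) (tgt C f))) (on_ar (nt_src \<beta>) (component \<alpha> (tgt C f))))
        (on_ar (nt_src \<beta>) (on_ar (nt_src \<alpha>) f)) =
      cmp E (on_ar (nt_tgt \<beta>) (on_ar (nt_tgt \<alpha>) f))
        (cmp E (component \<beta> (on_ob (nt_tgt \<alpha>) (src C f))) (on_ar (nt_src \<beta>) (component \<alpha> (src C f))))"
    (is "?l = ?r") if f: "f \<in> Arr C" for f
  proof -
    have "?l = cmp E (component \<beta> (on_ob (nt_tgt \<alpha>) (tgt C f)))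
        (on_ar (nt_src \<beta>) (cmp D (component \<alpha> (tgt C f)) (on_ar (nt_src \<alpha>) f)))"
      using f by (simp flip: E.cmp_assoc add: is_functorD(6)[OF b(1)])
    also have "\<dots> = cmp E (component \<beta> (on_ob (nt_tgt \<alpha>) (tgt C f)))
        (cmp E (on_ar (nt_src \<beta>) (on_ar (nt_tgt \<alpha>) f)) (on_ar (nt_src \<beta>) (component \<alpha> (src C f))))"
      using f by (simp add: a(6) is_functorD(6)[OF b(1)])
    also have "\<dots> = cmp E (cmp E (component \<beta> (tgt D (on_ar (nt_tgt \<alpha>) f))) (on_ar (nt_src \<beta>) (on_ar (nt_tgt \<alpha>) f)))
        (on_ar (nt_src \<beta>) (component \<alpha> (src C f)))"
      using f by (simp add: E.cmp_assoc)
    also have "\<dots> = ?r"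
      using f by (subst b(6)) (simp_all add: E.cmp_assoc)
    finally show ?thesis .
  qed
  then show ?thesis
    using is_functor_comp[OF assms(1) a(1) b(1)] is_functor_comp[OF assms(1) a(2) b(2)]
    by (auto simp: natural_def func_comp_def)
qed

lemma func_comp_assoc:
  assumes "is_functor W X F" "is_functor X Y G"
  shows "func_comp W H (func_comp W G F) = func_comp W (func_comp X H G) F"
  using is_functorD(1,2)[OF assms(1)]
  by (auto simp: func_comp_def compose_def fun_eq_iff)

lemma func_comp_id:
  assumes "is_functor X Y F"
  shows "func_comp X F (func_id X) = F" "func_comp X (func_id Y) F = F"
proof -
  have "on_ob F c = undefined" if "c \<notin> Obj X" for c
    using is_functorD(7)[OF assms] that by (simp add: extensional_def)
  moreover have "on_ar F f = undefined" if "f \<notin> Arr X" for f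
    using is_functorD(8)[OF assms] that by (simp add: extensional_def)
  ultimately show "func_comp X F (func_id X) = F" "func_comp X (func_id Y) F = F"
    using is_functorD(1,2)[OF assms]
    by (auto simp: func_comp_def func_id_def compose_def fun_eq_iff intro!: func.equality)
qed

lemma category_site_hom:
  assumes "is_site X" "is_site Y"
  shows "category (site_hom X Y)"
proof -
  have cX: "category (fst X)" and cY: "category (fst Y)"
    using assms by (auto simp: is_site_def)
  interpret X: category "fst X" by fact
  interpret Y: category "fst Y" by fact
  note sf = strict_morphism_functor
  show ?thesis
  proof (unfold_locales, goal_cases)
    case (3 F)
    then show ?case
      using natural_ident[OF cX cY] by (auto simp: site_hom_def sf)
  next
    case (6 \<alpha> \<beta>)
    then show ?case
      using natural_vcomp[OF cX cY] by (auto simp: site_hom_def)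
  next
    case (9 \<alpha>)
    then have n: "natural (fst X) (fst Y) \<alpha>" by (simp add: site_hom_def)
    note a = naturalD[OF n]
    have "component \<alpha> x = undefined" if "x \<notin> Obj (fst X)" for x
      using a(7) that by (simp add: extensional_def)
    moreover have "cmp (fst Y) (component \<alpha> x) (ident (fst Y) (on_ob (nt_src \<alpha>) x)) = component \<alpha> x"
      if "x \<in> Obj (fst X)" for x
      using Y.cmp_ident_right[OF a(3)] that by (simp add: a)
    ultimately show ?case
      by (auto simp: site_hom_def fun_eq_iff intro!: nat_trans.equality)
  next
    case (10 \<alpha>)
    then have n: "natural (fst X) (fst Y) \<alpha>" by (simp add: site_hom_def)
    note a = naturalD[OF n]
    have "component \<alpha> x = undefined" if "x \<notin> Obj (fst X)" for x
      using a(7) that by (simp add: extensional_def)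
    moreover have "cmp (fst Y) (ident (fst Y) (on_ob (nt_tgt \<alpha>) x)) (component \<alpha> x) = component \<alpha> x"
      if "x \<in> Obj (fst X)" for x
      using Y.cmp_ident_left[OF a(3)] that by (simp add: a)
    ultimately show ?case
      by (auto simp: site_hom_def fun_eq_iff intro!: nat_trans.equality)
  next
    case (11 \<alpha> \<beta> \<gamma>)
    then have n: "natural (fst X) (fst Y) \<alpha>" "natural (fst X) (fst Y) \<beta>" "natural (fst X) (fst Y) \<gamma>"
      and e: "nt_src \<beta> = nt_tgt \<alpha>" "nt_src \<gamma> = nt_tgt \<beta>" by (simp_all add: site_hom_def)
    show ?case
      using naturalD[OF n(1)] naturalD[OF n(2)] naturalD[OF n(3)] e
      by (auto simp: site_hom_def Y.cmp_assoc cong: restrict_cong)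
  qed (simp_all add: site_hom_def)
qed


lemma site_categories: "is_site X \<Longrightarrow> category (fst X)"
  by (auto simp: is_site_def)

lemma two_category_SITEs: "two_category SITEs"
proof (rule two_category.intro, goal_cases)
  case (1 X Y)
  then show ?case by (simp add: SITEs_def category_site_hom)
next
  case (2 X)
  then show ?case by (simp add: SITEs_def site_hom_def strict_morphism_id)
next
  case (3 X Y Z f g)
  then show ?case by (auto simp: SITEs_def site_hom_def intro: strict_morphism_comp)
next
  case (4 X Y Z \<alpha> \<beta>)
  then show ?case
    by (auto simp: SITEs_def site_hom_def intro: strict_morphism_comp
        intro!: natural_hcomp[of _ "fst Y"] site_categories)
next
  case (5 X Y Z f g)
  then have f: "is_functor (fst X) (fst Y) f" and g: "is_functor (fst Y) (fst Z) g"
    and c: "category (fst X)" "category (fst Y)" "category (fst Z)"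
    by (auto simp: SITEs_def site_hom_def intro: strict_morphism_functor site_categories)
  interpret Z: category "fst Z" by fact
  have "cmp (fst Z) (ident (fst Z) z) (ident (fst Z) z) = ident (fst Z) z" if "z \<in> Obj (fst Z)" for z
    using Z.cmp_ident_left[of "ident (fst Z) z"] that by (simp add: Z.ident_Arr Z.tgt_ident)
  then show ?case
    using is_functorD[OF f] is_functorD[OF g]
    by (auto simp: SITEs_def site_hom_def func_comp_def compose_def fun_eq_iff)
next
  case (6 X Y Z \<alpha> \<alpha>' \<beta> \<beta>')
  then have n: "natural (fst X) (fst Y) \<alpha>" "natural (fst X) (fst Y) \<alpha>'"
      "natural (fst Y) (fst Z) \<beta>" "natural (fst Y) (fst Z) \<beta>'"
    and e: "nt_src \<alpha>' = nt_tgt \<alpha>" "nt_src \<beta>' = nt_tgt \<beta>"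
    and c: "category (fst X)" "category (fst Y)" "category (fst Z)"
    by (auto simp: SITEs_def site_hom_def intro: site_categories)
  interpret Y: category "fst Y" by fact
  interpret Z: category "fst Z" by fact
  note a = naturalD[OF n(1)] and a' = naturalD[OF n(2)] and b = naturalD[OF n(3)] and b' = naturalD[OF n(4)]
  note fs = is_functorD(1-4)[OF a(1)] is_functorD(1-4)[OF a(2)] is_functorD(1-4)[OF a'(2)]
    is_functorD(1-4)[OF b(1)] is_functorD(1-4)[OF b(2)] is_functorD(1-4)[OF b'(2)]
  note [simp] = a(3-5) a'(3-5) b(3-5) b'(3-5) fs e Z.cmp_Arr Z.src_cmp Z.tgt_cmp
    Y.src_Obj Y.tgt_Obj
  have "cmp (fst Z) (cmp (fst Z) (component \<beta>' (on_ob (nt_tgt \<alpha>') x)) (component \<beta> (on_ob (nt_tgt \<alpha>') x)))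
          (on_ar (nt_src \<beta>) (cmp (fst Y) (component \<alpha>' x) (component \<alpha> x))) =
        cmp (fst Z) (cmp (fst Z) (component \<beta>' (on_ob (nt_tgt \<alpha>') x)) (on_ar (nt_tgt \<beta>) (component \<alpha>' x)))
          (cmp (fst Z) (component \<beta> (on_ob (nt_tgt \<alpha>) x)) (on_ar (nt_src \<beta>) (component \<alpha> x)))"
    (is "?l = ?r") if x: "x \<in> Obj (fst X)" for x
  proof -
    have "?l = cmp (fst Z) (component \<beta>' (on_ob (nt_tgt \<alpha>') x))
        (cmp (fst Z) (cmp (fst Z) (component \<beta> (tgt (fst Y) (component \<alpha>' x))) (on_ar (nt_src \<beta>) (component \<alpha>' x)))
           (on_ar (nt_src \<beta>) (component \<alpha> x)))"
      using x by (simp add: is_functorD(6)[OF b(1)] flip: Z.cmp_assoc)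
    also have "\<dots> = ?r"
      using x by (subst b(6)) (simp_all flip: Z.cmp_assoc)
    finally show ?thesis .
  qed
  then show ?case
    by (auto simp: SITEs_def site_hom_def fun_eq_iff)
next
  case (7 W X Y Z f g h)
  then show ?case
    by (auto simp: SITEs_def site_hom_def intro!: func_comp_assoc strict_morphism_functor)
next
  case (8 W X Y Z \<alpha> \<beta> \<gamma>)
  then have n: "natural (fst W) (fst X) \<alpha>" "natural (fst X) (fst Y) \<beta>" "natural (fst Y) (fst Z) \<gamma>"
    and c: "category (fst Y)" "category (fst Z)"
    by (auto simp: SITEs_def site_hom_def intro: site_categories)
  interpret Y: category "fst Y" by fact
  interpret Z: category "fst Z" by fact
  note a = naturalD[OF n(1)] and b = naturalD[OF n(2)] and g = naturalD[OF n(3)]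
  note fs = is_functorD(1-4)[OF a(1)] is_functorD(1-4)[OF a(2)] is_functorD(1-4)[OF b(1)]
    is_functorD(1-4)[OF b(2)] is_functorD(1-4)[OF g(1)] is_functorD(1-4)[OF g(2)]
  note [simp] = a(3-5) b(3-5) g(3-5) fs Z.cmp_Arr Z.src_cmp Z.tgt_cmp
  have "func_comp (fst W) F (func_comp (fst W) G H) = func_comp (fst W) (func_comp (fst X) F G) H"
    if "is_functor (fst W) (fst X) H" "is_functor (fst X) (fst Y) G" for F G H
    using that by (rule func_comp_assoc)
  then show ?case
    using a(1,2) b(1,2)
    by (auto simp: SITEs_def site_hom_def fun_eq_iff is_functorD(6)[OF g(1)] func_comp_def
        compose_def Z.cmp_assoc)
next
  case (9 X Y f)
  then show ?case
    by (auto simp: SITEs_def site_hom_def intro!: func_comp_id strict_morphism_functor)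
next
  case (10 X Y \<alpha>)
  then have n: "natural (fst X) (fst Y) \<alpha>"
    and c: "category (fst X)" "category (fst Y)"
    by (auto simp: SITEs_def site_hom_def intro: site_categories)
  interpret X: category "fst X" by fact
  interpret Y: category "fst Y" by fact
  note a = naturalD[OF n]
  have "component \<alpha> x = undefined" if "x \<notin> Obj (fst X)" for x
    using a(7) that by (simp add: extensional_def)
  moreover have "cmp (fst Y) (component \<alpha> x) (ident (fst Y) (on_ob (nt_src \<alpha>) x)) = component \<alpha> x"
      "cmp (fst Y) (ident (fst Y) (on_ob (nt_tgt \<alpha>) x)) (component \<alpha> x) = component \<alpha> x"
    if "x \<in> Obj (fst X)" for x
    using Y.cmp_ident_right[OF a(3)] Y.cmp_ident_left[OF a(3)] that by (simp_all add: a)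
  ultimately show ?case
    using a(3-5) is_functorD[OF a(1)] is_functorD[OF a(2)]
    by (auto simp: SITEs_def site_hom_def fun_eq_iff
        func_comp_id[OF a(1), unfolded func_id_def] func_comp_id[OF a(2), unfolded func_id_def] func_id_def X.ident_Arr
        intro!: nat_trans.equality)
qed

end

theory Submission
  imports Defs
begin

text \<open>
  Write \<open>P\<close> for the functor from \<open>E\<close> to \<open>B\<close>. Both halves rest on comparing Cartesian 2-cells of sites
  with natural transformations all of whose components are \<open>P\<close>-Cartesian.

  (a) Let \<open>P\<close> be a fibration and give \<open>E\<close> the induced coverings. A natural transformation
  \<open>\<alpha>\<close> from \<open>G\<close> to \<open>P F\<close> is lifted one component at a time (\<open>pointwise_cartesian_lift\<close>), and
  the universal property of the lifts makes their sources into a functor \<open>H\<close> over \<open>G\<close>. This \<open>H\<close> is a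
  strict morphism: if \<open>f\<close> belongs to a covering, then \<open>F f\<close> is Cartesian, so in the naturality square of
  the lift at \<open>f\<close> the composite is Cartesian, and cancelling the component on the left shows that
  \<open>H f\<close> is Cartesian; moreover the image of the covering under \<open>P H = G\<close> is a covering. So
  \<open>H\<close> sends coverings to induced coverings (\<open>cartesian_lift_strict\<close>). Componentwise Cartesian
  2-cells are Cartesian, and since a Cartesian 2-cell is isomorphic to a componentwise Cartesian lift of
  the same 2-cell, the converse holds too. Precomposition only reindexes components and hence
  preserves Cartesian 2-cells.

  (b) A functor is tested against two kinds of sites. On the one-point site without coverings, every
  functor is strict, so the strict morphisms from it to \<open>E\<close> and their 2-cells form a copy of the
  category \<open>E\<close>; condition (i) of an internal fibration then says that \<open>P\<close> is a
  fibration, and condition (ii) for the points of a site says that Cartesian 2-cells are componentwise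
  Cartesian. Now let \<open>S\<close> be a nonempty induced covering of \<open>e\<close>. Take the cone consisting of one
  arrow to an apex for each member of \<open>S\<close>, with these arrows as the only covering. The functor
  constant at \<open>e\<close> is strict, as it sends the covering to the identity covering, and so is the functor
  that displays \<open>P S\<close>. There is an evident 2-cell from the latter to the image of the former, with component \<open>P s\<close> at
  the foot of \<open>s\<close> and the identity at the apex. Its Cartesian lift is an isomorphism \<open>\<theta>\<close> at the apex, and its domain
  displays a covering \<open>h S\<close> of the source of \<open>\<theta>\<close> for which \<open>\<theta> (h s)\<close> lies over
  \<open>P s\<close> (\<open>lift_of_induced_covering\<close>). Hence \<open>\<theta> (h s)\<close> factors through the Cartesian arrow
  \<open>s\<close>, while the axioms applied to \<open>\<theta>\<close> and \<open>h S\<close> give a covering refining these composites.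
\<close>

section \<open>Cartesian arrows\<close>

locale category_over = E: category E + B: category B
  for E :: "('e, 'a) category" and B :: "('p, 'b) category" +
  fixes P :: "('e, 'a, 'p, 'b) func"
  assumes P_functor: "is_functor E B P"
begin

lemmas [simp] =
  E.src_Obj E.tgt_Obj E.ident_Arr E.src_ident E.tgt_ident E.cmp_Arr E.src_cmp E.tgt_cmp
  E.cmp_ident_left E.cmp_ident_right
  B.src_Obj B.tgt_Obj B.ident_Arr B.src_ident B.tgt_ident B.cmp_Arr B.src_cmp B.tgt_cmp
  B.cmp_ident_left B.cmp_ident_right
  is_functorD(1-6)[OF P_functor]

lemma ident_left [simp]:
  "\<lbrakk>f \<in> Arr E; tgt E f = e\<rbrakk> \<Longrightarrow> cmp E (ident E e) f = f"
  "\<lbrakk>g \<in> Arr B; tgt B g = b\<rbrakk> \<Longrightarrow> cmp B (ident B b) g = g"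
  by auto

lemma ident_right [simp]:
  "\<lbrakk>f \<in> Arr E; src E f = e\<rbrakk> \<Longrightarrow> cmp E f (ident E e) = f"
  "\<lbrakk>g \<in> Arr B; src B g = b\<rbrakk> \<Longrightarrow> cmp B g (ident B b) = g"
  by auto

lemma cartesian_Arr: "cartesian E B P \<phi> \<Longrightarrow> \<phi> \<in> Arr E"
  by (simp add: cartesian_def)

lemma cartesian_ex1:
  assumes "cartesian E B P \<phi>" "\<psi> \<in> Arr E" "g \<in> Arr B" "tgt E \<psi> = tgt E \<phi>"
    "src B g = on_ob P (src E \<psi>)" "tgt B g = on_ob P (src E \<phi>)"
    "cmp B (on_ar P \<phi>) g = on_ar P \<psi>"
  shows "\<exists>!\<chi>. \<chi> \<in> Arr E \<and> src E \<chi> = src E \<psi> \<and> tgt E \<chi> = src E \<phi> \<and>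
    on_ar P \<chi> = g \<and> cmp E \<phi> \<chi> = \<psi>"
  using assms unfolding cartesian_def by blast

lemma cartesian_factor:
  assumes "cartesian E B P \<phi>" "\<psi> \<in> Arr E" "g \<in> Arr B" "tgt E \<psi> = tgt E \<phi>"
    "src B g = on_ob P (src E \<psi>)" "tgt B g = on_ob P (src E \<phi>)"
    "cmp B (on_ar P \<phi>) g = on_ar P \<psi>"
  obtains \<chi> where "\<chi> \<in> Arr E" "src E \<chi> = src E \<psi>" "tgt E \<chi> = src E \<phi>"
    "on_ar P \<chi> = g" "cmp E \<phi> \<chi> = \<psi>"
  using cartesian_ex1[OF assms] by blast

lemma cartesian_unique:
  assumes c: "cartesian E B P \<phi>"
    and "\<chi> \<in> Arr E" "tgt E \<chi> = src E \<phi>" "\<chi>' \<in> Arr E" "tgt E \<chi>' = src E \<phi>"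
    "src E \<chi> = src E \<chi>'" "on_ar P \<chi> = on_ar P \<chi>'" "cmp E \<phi> \<chi> = cmp E \<phi> \<chi>'"
  shows "\<chi> = \<chi>'"
proof -
  have \<phi>: "\<phi> \<in> Arr E" using c by (rule cartesian_Arr)
  have "cmp B (on_ar P \<phi>) (on_ar P \<chi>) = on_ar P (cmp E \<phi> \<chi>)"
    using assms \<phi> by simp
  then show ?thesis
    using cartesian_ex1[OF c, of "cmp E \<phi> \<chi>" "on_ar P \<chi>"] assms \<phi> by auto
qed

lemma cartesian_comp:
  assumes \<phi>: "cartesian E B P \<phi>" and \<psi>: "cartesian E B P \<psi>" and e: "src E \<phi> = tgt E \<psi>"
  shows "cartesian E B P (cmp E \<phi> \<psi>)"
  unfolding cartesian_def
proof (intro conjI ballI impI, goal_cases)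
  case 1
  show ?case using assms by (simp add: cartesian_Arr)
next
  case (2 \<theta> g)
  note [simp] = cartesian_Arr[OF \<phi>] cartesian_Arr[OF \<psi>]
  from 2 e have *: "tgt E \<theta> = tgt E \<phi>" "src B g = on_ob P (src E \<theta>)" "tgt B g = on_ob P (src E \<psi>)"
    "cmp B (on_ar P \<phi>) (cmp B (on_ar P \<psi>) g) = on_ar P \<theta>"
    by (auto simp: B.cmp_assoc)
  obtain \<zeta> where \<zeta>: "\<zeta> \<in> Arr E" "src E \<zeta> = src E \<theta>" "tgt E \<zeta> = src E \<phi>"
    "on_ar P \<zeta> = cmp B (on_ar P \<psi>) g" "cmp E \<phi> \<zeta> = \<theta>"
    using cartesian_factor[OF \<phi>, of \<theta> "cmp B (on_ar P \<psi>) g"] 2 * e by auto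
  obtain \<chi> where \<chi>: "\<chi> \<in> Arr E" "src E \<chi> = src E \<zeta>" "tgt E \<chi> = src E \<psi>"
    "on_ar P \<chi> = g" "cmp E \<psi> \<chi> = \<zeta>"
    using cartesian_factor[OF \<psi>, of \<zeta> g] 2 * e \<zeta> by auto
  show ?case
  proof (rule ex1I[of _ \<chi>], goal_cases)
    case 1
    have "cmp E (cmp E \<phi> \<psi>) \<chi> = cmp E \<phi> (cmp E \<psi> \<chi>)"
      using \<chi>(1-3) e by (simp add: E.cmp_assoc)
    then show ?case using \<chi> \<zeta> e by simp
  next
    case (2 \<chi>')
    then have \<chi>': "\<chi>' \<in> Arr E" "src E \<chi>' = src E \<theta>" "tgt E \<chi>' = src E \<psi>" "on_ar P \<chi>' = g"
      "cmp E \<phi> (cmp E \<psi> \<chi>') = \<theta>"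
      using e by (auto simp: E.cmp_assoc)
    have "cmp E \<psi> \<chi>' = cmp E \<psi> \<chi>"
      by (rule cartesian_unique[OF \<phi>]) (use \<chi> \<chi>' \<zeta> e in auto)
    note eq = this
    show ?case
      by (rule cartesian_unique[OF \<psi>]) (use eq \<chi>(1-4) \<chi>'(1-4) \<zeta>(2) in simp_all)
  qed
qed

text \<open>
  Filling a triangle for \<^term>\<open>\<psi>\<close> amounts to filling the triangle obtained by composing with
  \<^term>\<open>\<phi>\<close>, because arrows into the source of \<^term>\<open>\<phi>\<close> over a given arrow are determined by their
  composite with \<^term>\<open>\<phi>\<close>.
\<close>

lemma cartesian_cancel:
  assumes \<phi>: "cartesian E B P \<phi>" and c: "cartesian E B P (cmp E \<phi> \<psi>)"
    and \<psi>[simp]: "\<psi> \<in> Arr E" and e: "src E \<phi> = tgt E \<psi>"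
  shows "cartesian E B P \<psi>"
  unfolding cartesian_def
proof (intro conjI ballI impI, goal_cases)
  case 1
  show ?case by simp
next
  case (2 \<theta> g)
  note [simp] = cartesian_Arr[OF \<phi>]
  have ex1: "\<exists>!\<chi>. \<chi> \<in> Arr E \<and> src E \<chi> = src E (cmp E \<phi> \<theta>) \<and> tgt E \<chi> = src E (cmp E \<phi> \<psi>) \<and>
      on_ar P \<chi> = g \<and> cmp E (cmp E \<phi> \<psi>) \<chi> = cmp E \<phi> \<theta>"
    by (rule cartesian_ex1[OF c]) (use 2 e in \<open>auto simp flip: B.cmp_assoc\<close>)
  have "cmp E (cmp E \<phi> \<psi>) \<chi> = cmp E \<phi> \<theta> \<longleftrightarrow> cmp E \<psi> \<chi> = \<theta>"
    if "\<chi> \<in> Arr E" "src E \<chi> = src E \<theta>" "tgt E \<chi> = src E \<psi>" "on_ar P \<chi> = g" for \<chi>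
  proof
    assume *: "cmp E (cmp E \<phi> \<psi>) \<chi> = cmp E \<phi> \<theta>"
    show "cmp E \<psi> \<chi> = \<theta>"
      by (rule cartesian_unique[OF \<phi>]) (use 2 e that * in \<open>auto simp: E.cmp_assoc\<close>)
  qed (use 2 e that in \<open>auto simp flip: E.cmp_assoc\<close>)
  with ex1 show ?case using 2 e by (simp cong: conj_cong)
qed

text \<open>
  The inverse is the factorisation of the identity of the target over the inverse in the base.
\<close>

lemma cartesian_over_iso:
  assumes \<phi>: "cartesian E B P \<phi>" and i: "is_iso B (on_ar P \<phi>)"
  shows "is_iso E \<phi>"
proof -
  note [simp] = cartesian_Arr[OF \<phi>]
  obtain g where g: "g \<in> Arr B" "src B g = on_ob P (tgt E \<phi>)" "tgt B g = on_ob P (src E \<phi>)"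
    "cmp B g (on_ar P \<phi>) = ident B (on_ob P (src E \<phi>))"
    "cmp B (on_ar P \<phi>) g = ident B (on_ob P (tgt E \<phi>))"
    using i by (auto simp: is_iso_def)
  obtain \<chi> where \<chi>: "\<chi> \<in> Arr E" "src E \<chi> = tgt E \<phi>" "tgt E \<chi> = src E \<phi>" "on_ar P \<chi> = g"
    "cmp E \<phi> \<chi> = ident E (tgt E \<phi>)"
    using cartesian_factor[OF \<phi>, of "ident E (tgt E \<phi>)" g] g by auto
  have "cmp E \<chi> \<phi> = ident E (src E \<phi>)"
    by (rule cartesian_unique[OF \<phi>]) (use \<chi> g in \<open>auto simp: E.cmp_assoc\<close>)
  then show ?thesis using \<chi> by (auto simp: is_iso_def)
qed

lemma iso_cartesian:
  assumes "is_iso E \<phi>"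
  shows "cartesian E B P \<phi>"
proof -
  obtain \<phi>' where i: "\<phi> \<in> Arr E" "\<phi>' \<in> Arr E" "src E \<phi>' = tgt E \<phi>" "tgt E \<phi>' = src E \<phi>"
    "cmp E \<phi>' \<phi> = ident E (src E \<phi>)" "cmp E \<phi> \<phi>' = ident E (tgt E \<phi>)"
    using assms by (auto simp: is_iso_def)
  show ?thesis
    unfolding cartesian_def
  proof (intro conjI ballI impI, goal_cases)
    case 1
    show ?case by (rule i)
  next
    case (2 \<psi> g)
    have "cmp B (on_ar P \<phi>') (on_ar P \<psi>) = cmp B (on_ar P \<phi>') (cmp B (on_ar P \<phi>) g)"
      using 2 by simp
    also have "\<dots> = cmp B (cmp B (on_ar P \<phi>') (on_ar P \<phi>)) g"
      by (rule B.cmp_assoc) (use 2 i(1-4) in simp_all)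
    also have "cmp B (on_ar P \<phi>') (on_ar P \<phi>) = on_ar P (cmp E \<phi>' \<phi>)"
      using i(1-4) by simp
    also have "cmp B \<dots> g = g"
      using 2 i by simp
    finally have g: "cmp B (on_ar P \<phi>') (on_ar P \<psi>) = g" .
    show ?case
    proof (rule ex1I[of _ "cmp E \<phi>' \<psi>"], goal_cases)
      case 1
      show ?case using 2 i g by (simp add: E.cmp_assoc)
    next
      case (2 \<chi>)
      then have "cmp E \<phi>' \<psi> = cmp E (cmp E \<phi>' \<phi>) \<chi>"
        using i(1-4) by (auto simp: E.cmp_assoc)
      then show ?case using 2 i by simp
    qed
  qed
qed

text \<open>
  The factorisation of one arrow through the other over an identity is Cartesian by cancellation, and
  a Cartesian arrow over an isomorphism is invertible.
\<close>

lemma cartesian_comparison: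
  assumes \<phi>: "cartesian E B P \<phi>" and \<psi>: "cartesian E B P \<psi>"
    and t: "tgt E \<phi> = tgt E \<psi>" and p: "on_ar P \<phi> = on_ar P \<psi>"
  obtains \<chi> where "is_iso E \<chi>" "src E \<chi> = src E \<phi>" "tgt E \<chi> = src E \<psi>" "cmp E \<psi> \<chi> = \<phi>"
proof -
  note [simp] = cartesian_Arr[OF \<phi>] cartesian_Arr[OF \<psi>]
  let ?b = "src B (on_ar P \<phi>)"
  have b: "?b = on_ob P (src E \<phi>)" "?b = on_ob P (src E \<psi>)" "?b \<in> Obj B"
    using p by (auto simp flip: is_functorD(3)[OF P_functor])
  have i: "cmp B (on_ar P \<phi>) (ident B ?b) = on_ar P \<phi>"
    by simp
  obtain \<chi> where \<chi>: "\<chi> \<in> Arr E" "src E \<chi> = src E \<phi>" "tgt E \<chi> = src E \<psi>"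
    "on_ar P \<chi> = ident B ?b" "cmp E \<psi> \<chi> = \<phi>"
    by (rule cartesian_factor[OF \<psi>, of \<phi> "ident B ?b"]) (use b t p i in auto)
  have "cartesian E B P \<chi>"
    by (rule cartesian_cancel[OF \<psi>]) (use \<phi> \<chi> in auto)
  moreover have "is_iso B (on_ar P \<chi>)"
    unfolding \<chi>(4) is_iso_def by (intro conjI bexI[of _ "ident B ?b"]) (use b(3) in auto)
  ultimately show ?thesis
    using that \<chi> cartesian_over_iso by blast
qed

end

section \<open>Cartesian 2-cells between strict morphisms of sites\<close>

lemma site_hom_simps [simp]:
  "Obj (site_hom X Y) = {F. strict_morphism X Y F}"
  "src (site_hom X Y) = nt_src"
  "tgt (site_hom X Y) = nt_tgt"
  by (simp_all add: site_hom_def)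

lemma SITEs_simps [simp]:
  "Obj2 SITEs = {X. is_site X}" "Hom2 SITEs = site_hom"
  by (simp_all add: SITEs_def)

lemma component_cmp_site_hom [simp]:
  "c \<in> Obj (fst X) \<Longrightarrow>
    component (cmp (site_hom X Y) \<beta> \<alpha>) c = cmp (fst Y) (component \<beta> c) (component \<alpha> c)"
  by (simp add: site_hom_def)

lemma component_ident_site_hom [simp]:
  "c \<in> Obj (fst X) \<Longrightarrow> component (ident (site_hom X Y) F) c = ident (fst Y) (on_ob F c)"
  by (simp add: site_hom_def)

lemma site_hom_ArrI:
  "\<lbrakk>natural (fst X) (fst Y) \<alpha>; strict_morphism X Y (nt_src \<alpha>); strict_morphism X Y (nt_tgt \<alpha>)\<rbrakk>
    \<Longrightarrow> \<alpha> \<in> Arr (site_hom X Y)"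
  by (simp add: site_hom_def)

lemma site_hom_ArrD:
  assumes "\<alpha> \<in> Arr (site_hom X Y)"
  shows "natural (fst X) (fst Y) \<alpha>" "strict_morphism X Y (nt_src \<alpha>)" "strict_morphism X Y (nt_tgt \<alpha>)"
  using assms by (simp_all add: site_hom_def)

lemma nat_trans_eqI:
  assumes "natural C D \<alpha>" "natural C D \<beta>" "nt_src \<alpha> = nt_src \<beta>" "nt_tgt \<alpha> = nt_tgt \<beta>"
    and "\<And>c. c \<in> Obj C \<Longrightarrow> component \<alpha> c = component \<beta> c"
  shows "\<alpha> = \<beta>"
  using assms extensionalityI[OF naturalD(7)[OF assms(1)] naturalD(7)[OF assms(2)]]
  by (auto intro!: nat_trans.equality)

lemma functor_eqI:
  assumes "is_functor C D F" "is_functor C D G"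
    and "\<And>c. c \<in> Obj C \<Longrightarrow> on_ob F c = on_ob G c" "\<And>f. f \<in> Arr C \<Longrightarrow> on_ar F f = on_ar G f"
  shows "F = G"
  using assms extensionalityI[OF is_functorD(7)[OF assms(1)] is_functorD(7)[OF assms(2)]]
    extensionalityI[OF is_functorD(8)[OF assms(1)] is_functorD(8)[OF assms(2)]]
  by (auto intro!: func.equality)

lemma func_comp_apply [simp]:
  "c \<in> Obj C \<Longrightarrow> on_ob (func_comp C G F) c = on_ob G (on_ob F c)"
  "f \<in> Arr C \<Longrightarrow> on_ar (func_comp C G F) f = on_ar G (on_ar F f)"
  by (simp_all add: func_comp_def compose_def)

definition whisker_left ::
  "('o, 'a) category \<Rightarrow> ('p, 'b, 'q, 'd) func \<Rightarrow> ('o, 'a, 'p, 'b) nat_trans \<Rightarrow>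
    ('o, 'a, 'q, 'd) nat_trans" where
  "whisker_left C P \<alpha> = \<lparr>nt_src = func_comp C P (nt_src \<alpha>), nt_tgt = func_comp C P (nt_tgt \<alpha>),
     component = (\<lambda>c\<in>Obj C. on_ar P (component \<alpha> c))\<rparr>"

definition whisker_right ::
  "('o, 'a) category \<Rightarrow> ('p, 'b, 'q, 'd) nat_trans \<Rightarrow> ('o, 'a, 'p, 'b) func \<Rightarrow>
    ('o, 'a, 'q, 'd) nat_trans" where
  "whisker_right C \<alpha> F = \<lparr>nt_src = func_comp C (nt_src \<alpha>) F, nt_tgt = func_comp C (nt_tgt \<alpha>) F,
     component = (\<lambda>c\<in>Obj C. component \<alpha> (on_ob F c))\<rparr>"

lemma whisker_simps [simp]:
  "nt_src (whisker_left C P \<alpha>) = func_comp C P (nt_src \<alpha>)"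
  "nt_tgt (whisker_left C P \<alpha>) = func_comp C P (nt_tgt \<alpha>)"
  "c \<in> Obj C \<Longrightarrow> component (whisker_left C P \<alpha>) c = on_ar P (component \<alpha> c)"
  "nt_src (whisker_right C \<beta> F) = func_comp C (nt_src \<beta>) F"
  "nt_tgt (whisker_right C \<beta> F) = func_comp C (nt_tgt \<beta>) F"
  "c \<in> Obj C \<Longrightarrow> component (whisker_right C \<beta> F) c = component \<beta> (on_ob F c)"
  by (simp_all add: whisker_left_def whisker_right_def)

text \<open>
  Postcomposition and precomposition in the 2-category of sites horizontally compose with an identity
  2-cell; unit laws reduce this to whiskering, which is easier to compute with.
\<close>

lemma on_ob_postcomp_SITEs:
  "strict_morphism X Y F \<Longrightarrow> on_ob (postcomp SITEs X Y Z P) F = func_comp (fst X) P F"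
  by (simp add: postcomp_def SITEs_def)

lemma on_ar_postcomp_SITEs:
  assumes "category (fst Z)" "is_functor (fst Y) (fst Z) P" "\<alpha> \<in> Arr (site_hom X Y)"
  shows "on_ar (postcomp SITEs X Y Z P) \<alpha> = whisker_left (fst X) P \<alpha>"
proof -
  note n = naturalD[OF site_hom_ArrD(1)[OF assms(3)]] and P = is_functorD[OF assms(2)]
  have "cmp (fst Z) (ident (fst Z) (on_ob P (on_ob (nt_tgt \<alpha>) c))) (on_ar P (component \<alpha> c)) =
      on_ar P (component \<alpha> c)" if "c \<in> Obj (fst X)" for c
    using category.cmp_ident_left[OF assms(1), of "on_ar P (component \<alpha> c)"] that by (simp add: n P)
  then show ?thesis
    using assms(3) is_functorD(1)[OF n(2)]
    by (auto simp: postcomp_def SITEs_def whisker_left_def site_hom_def fun_eq_iff)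
qed

lemma on_ar_precomp_SITEs:
  assumes "category (fst Z)" "is_functor (fst X) (fst Y) F" "\<alpha> \<in> Arr (site_hom Y Z)"
  shows "on_ar (precomp SITEs X Y Z F) \<alpha> = whisker_right (fst X) \<alpha> F"
proof -
  note n = naturalD[OF site_hom_ArrD(1)[OF assms(3)]] and F = is_functorD[OF assms(2)]
  have "cmp (fst Z) (component \<alpha> (on_ob F c)) (on_ar (nt_src \<alpha>) (ident (fst Y) (on_ob F c))) =
      component \<alpha> (on_ob F c)" if "c \<in> Obj (fst X)" for c
    using category.cmp_ident_right[OF assms(1), of "component \<alpha> (on_ob F c)"] that
    by (simp add: n F is_functorD[OF n(1)])
  then show ?thesis
    using assms(3) by (auto simp: precomp_def SITEs_def whisker_right_def site_hom_def fun_eq_iff)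
qed

lemma is_functor_postcomp_SITEs:
  assumes "is_site X" "is_site Y" "is_site Z" "strict_morphism Y Z P"
  shows "is_functor (site_hom X Y) (site_hom X Z) (postcomp SITEs X Y Z P)"
proof -
  interpret two_category SITEs by (rule two_category_SITEs)
  have O: "X \<in> Obj2 SITEs" "Y \<in> Obj2 SITEs" "Z \<in> Obj2 SITEs"
    and P: "P \<in> Obj (Hom2 SITEs Y Z)" and H: "site_hom = Hom2 SITEs"
    using assms by auto
  interpret XY: category "Hom2 SITEs X Y" using O category_Hom2 by blast
  interpret YZ: category "Hom2 SITEs Y Z" using O category_Hom2 by blast
  let ?i = "ident (Hom2 SITEs Y Z) P"
  have i: "?i \<in> Arr (Hom2 SITEs Y Z)" "src (Hom2 SITEs Y Z) ?i = P" "tgt (Hom2 SITEs Y Z) ?i = P"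
    using P YZ.ident_Arr YZ.src_ident YZ.tgt_ident by auto
  then have ii: "cmp (Hom2 SITEs Y Z) ?i ?i = ?i"
    using YZ.cmp_ident_left[OF i(1)] by simp
  have "hcomp SITEs X Y Z ?i (cmp (Hom2 SITEs X Y) \<beta> \<alpha>) =
      cmp (Hom2 SITEs X Z) (hcomp SITEs X Y Z ?i \<beta>) (hcomp SITEs X Y Z ?i \<alpha>)"
    if "\<alpha> \<in> Arr (Hom2 SITEs X Y)" "\<beta> \<in> Arr (Hom2 SITEs X Y)"
      "src (Hom2 SITEs X Y) \<beta> = tgt (Hom2 SITEs X Y) \<alpha>" for \<alpha> \<beta>
    using interchange[of X Y Z \<alpha> \<beta> ?i ?i] O i ii that by simp
  then show ?thesis
    unfolding is_functor_def postcomp_def H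
    using O P i hcomp_Arr[OF O] comp1_Obj[OF O] hcomp_ident[OF O]
      XY.src_Obj XY.tgt_Obj XY.ident_Arr XY.cmp_Arr by auto
qed

locale site_over = category_over E B P
  for E B :: "('o, 'a) category" and P :: "('o, 'a, 'o, 'a) func" +
  fixes KE KB :: "('o, 'a) covfun"
  assumes site_E: "is_site (E, KE)" and site_B: "is_site (B, KB)"
    and P_strict: "strict_morphism (E, KE) (B, KB) P"
begin

abbreviation "hom_E X \<equiv> site_hom X (E, KE)"
abbreviation "hom_B X \<equiv> site_hom X (B, KB)"
abbreviation "post X \<equiv> postcomp SITEs X (E, KE) (B, KB) P"

lemma post_simps [simp]:
  "strict_morphism X (E, KE) F \<Longrightarrow> on_ob (post X) F = func_comp (fst X) P F"
  "\<alpha> \<in> Arr (hom_E X) \<Longrightarrow> on_ar (post X) \<alpha> = whisker_left (fst X) P \<alpha>"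
  using on_ar_postcomp_SITEs[of "(B, KB)" "(E, KE)"] P_functor B.category_axioms
  by (simp_all add: on_ob_postcomp_SITEs)

lemma category_over_hom: "is_site X \<Longrightarrow> category_over (hom_E X) (hom_B X) (post X)"
  using category_site_hom is_functor_postcomp_SITEs site_E site_B P_strict
  by (intro category_over.intro category_over_axioms.intro) blast+

lemma internal_fibrationD:
  assumes "internal_fibration SITEs (E, KE) (B, KB) P"
  shows "is_site X \<Longrightarrow> grothendieck_fibration (hom_E X) (hom_B X) (post X)"
    and "\<lbrakk>is_site X; is_site Y; strict_morphism X Y F; cartesian (hom_E Y) (hom_B Y) (post Y) \<phi>\<rbrakk>
      \<Longrightarrow> cartesian (hom_E X) (hom_B X) (post X) (on_ar (precomp SITEs X Y (E, KE) F) \<phi>)"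
  using assms unfolding internal_fibration_def SITEs_simps site_hom_simps mem_Collect_eq by blast+

text \<open>
  Factorisations exist componentwise; that the components form a natural transformation, and that
  it is the only one, follows because two arrows over the same arrow agree once they agree
  after composition with a Cartesian arrow.
\<close>

lemma pointwise_cartesian_imp_cartesian:
  assumes "is_site X" "\<phi> \<in> Arr (hom_E X)"
    and pw: "\<And>c. c \<in> Obj (fst X) \<Longrightarrow> cartesian E B P (component \<phi> c)"
  shows "cartesian (hom_E X) (hom_B X) (post X) \<phi>"
  unfolding cartesian_def
proof (intro conjI ballI impI)
  let ?C = "fst X"
  interpret C: category ?C using assms(1) by (rule site_categories)
  interpret XE: category_over "hom_E X" "hom_B X" "post X"
    using assms(1) by (rule category_over_hom)
  show "\<phi> \<in> Arr (hom_E X)" by fact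
  fix \<psi> \<gamma>
  assume \<psi>: "\<psi> \<in> Arr (hom_E X)" and \<gamma>: "\<gamma> \<in> Arr (hom_B X)"
    and "tgt (hom_E X) \<psi> = tgt (hom_E X) \<phi> \<and>
      src (hom_B X) \<gamma> = on_ob (post X) (src (hom_E X) \<psi>) \<and>
      tgt (hom_B X) \<gamma> = on_ob (post X) (src (hom_E X) \<phi>) \<and>
      cmp (hom_B X) (on_ar (post X) \<phi>) \<gamma> = on_ar (post X) \<psi>"
  then have t: "nt_tgt \<psi> = nt_tgt \<phi>"
    and s\<gamma>: "nt_src \<gamma> = func_comp ?C P (nt_src \<psi>)" and t\<gamma>: "nt_tgt \<gamma> = func_comp ?C P (nt_src \<phi>)"
    and eq: "cmp (hom_B X) (whisker_left ?C P \<phi>) \<gamma> = whisker_left ?C P \<psi>"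
    using \<psi> \<open>\<phi> \<in> _\<close> by (auto simp: site_hom_ArrD)
  have n\<phi>: "natural ?C E \<phi>" and n\<psi>: "natural ?C E \<psi>" and n\<gamma>: "natural ?C B \<gamma>"
    using \<open>\<phi> \<in> _\<close> \<psi> \<gamma> by (simp_all add: site_hom_def)
  note [simp] = naturalD(3-5)[OF n\<phi>] naturalD(3-5)[OF n\<psi>] naturalD(3-5)[OF n\<gamma>]
    C.src_Obj C.tgt_Obj
  note [simp] = is_functorD(1-4)[OF naturalD(1)[OF n\<phi>]] is_functorD(1-4)[OF naturalD(1)[OF n\<psi>]]
    is_functorD(1-4)[OF naturalD(2)[OF n\<phi>]]
  have eqc: "cmp B (on_ar P (component \<phi> c)) (component \<gamma> c) = on_ar P (component \<psi> c)"
    if "c \<in> Obj ?C" for c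
    using arg_cong[OF eq, of "\<lambda>\<alpha>. component \<alpha> c"] that by simp
  have "\<exists>\<chi>. \<chi> \<in> Arr E \<and> src E \<chi> = on_ob (nt_src \<psi>) c \<and> tgt E \<chi> = on_ob (nt_src \<phi>) c \<and>
      on_ar P \<chi> = component \<gamma> c \<and> cmp E (component \<phi> c) \<chi> = component \<psi> c"
    if "c \<in> Obj ?C" for c
    by (rule cartesian_factor[OF pw[OF that], of "component \<psi> c" "component \<gamma> c"])
      (use that eqc[OF that] in \<open>auto simp: t s\<gamma> t\<gamma>\<close>)
  then obtain \<chi> where \<chi>: "\<And>c. c \<in> Obj ?C \<Longrightarrow> \<chi> c \<in> Arr E"
    "\<And>c. c \<in> Obj ?C \<Longrightarrow> src E (\<chi> c) = on_ob (nt_src \<psi>) c"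
    "\<And>c. c \<in> Obj ?C \<Longrightarrow> tgt E (\<chi> c) = on_ob (nt_src \<phi>) c"
    "\<And>c. c \<in> Obj ?C \<Longrightarrow> on_ar P (\<chi> c) = component \<gamma> c"
    "\<And>c. c \<in> Obj ?C \<Longrightarrow> cmp E (component \<phi> c) (\<chi> c) = component \<psi> c"
    by metis
  have nat: "cmp E (\<chi> (tgt ?C f)) (on_ar (nt_src \<psi>) f) = cmp E (on_ar (nt_src \<phi>) f) (\<chi> (src ?C f))"
    (is "?l = ?r") if f: "f \<in> Arr ?C" for f
  proof (rule cartesian_unique[OF pw[OF C.tgt_Obj[OF f]]])
    show "on_ar P ?l = on_ar P ?r"
      using naturalD(6)[OF n\<gamma> f] f by (simp add: \<chi>(1-4) s\<gamma> t\<gamma>)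
    have "cmp E (component \<phi> (tgt ?C f)) ?l = cmp E (component \<psi> (tgt ?C f)) (on_ar (nt_src \<psi>) f)"
      using f by (simp add: \<chi> E.cmp_assoc)
    also have "\<dots> = cmp E (on_ar (nt_tgt \<phi>) f) (cmp E (component \<phi> (src ?C f)) (\<chi> (src ?C f)))"
      using f naturalD(6)[OF n\<psi> f] by (simp add: \<chi> t)
    also have "\<dots> = cmp E (component \<phi> (tgt ?C f)) ?r"
      using f naturalD(6)[OF n\<phi> f] by (simp add: \<chi>(1-4) E.cmp_assoc)
    finally show "cmp E (component \<phi> (tgt ?C f)) ?l = cmp E (component \<phi> (tgt ?C f)) ?r" .
  qed (use f in \<open>simp_all add: \<chi>(1-4)\<close>)
  define \<theta> where "\<theta> = \<lparr>nt_src = nt_src \<psi>, nt_tgt = nt_src \<phi>, component = (\<lambda>c\<in>Obj ?C. \<chi> c)\<rparr>"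
  have n\<theta>: "natural ?C E \<theta>"
    using \<chi> nat naturalD(1)[OF n\<phi>] naturalD(1)[OF n\<psi>] by (simp add: \<theta>_def natural_def)
  have \<theta>: "\<theta> \<in> Arr (hom_E X)"
    using n\<theta> site_hom_ArrD(2)[OF \<psi>] site_hom_ArrD(2)[OF \<open>\<phi> \<in> _\<close>]
    by (simp add: site_hom_def \<theta>_def)
  show "\<exists>!\<chi>. \<chi> \<in> Arr (hom_E X) \<and> src (hom_E X) \<chi> = src (hom_E X) \<psi> \<and>
      tgt (hom_E X) \<chi> = src (hom_E X) \<phi> \<and>
      on_ar (post X) \<chi> = \<gamma> \<and> cmp (hom_E X) \<phi> \<chi> = \<psi>"
  proof (rule ex1I[of _ \<theta>], goal_cases)
    case 1
    have "on_ar (post X) \<theta> = \<gamma>"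
      unfolding post_simps(2)[OF \<theta>]
    proof (rule nat_trans_eqI)
      show "natural ?C B (whisker_left ?C P \<theta>)"
        using site_hom_ArrD(1)[OF is_functorD(2)[OF XE.P_functor \<theta>]] \<theta> by simp
    qed (use n\<gamma> \<chi> s\<gamma> t\<gamma> in \<open>simp_all add: \<theta>_def\<close>)
    moreover have "cmp (hom_E X) \<phi> \<theta> = \<psi>"
    proof (rule nat_trans_eqI)
      show "natural ?C E (cmp (hom_E X) \<phi> \<theta>)"
        using site_hom_ArrD(1)[OF XE.E.cmp_Arr[OF \<theta> \<open>\<phi> \<in> _\<close>]] by (simp add: \<theta>_def)
    qed (use n\<psi> \<chi> t in \<open>simp_all add: \<theta>_def site_hom_def\<close>)
    ultimately show ?case using \<theta> by (simp add: \<theta>_def)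
  next
    case (2 \<theta>')
    then have \<theta>': "\<theta>' \<in> Arr (hom_E X)" "nt_src \<theta>' = nt_src \<psi>" "nt_tgt \<theta>' = nt_src \<phi>"
      and c: "whisker_left ?C P \<theta>' = \<gamma>" "cmp (hom_E X) \<phi> \<theta>' = \<psi>"
      by auto
    have n\<theta>': "natural ?C E \<theta>'" using site_hom_ArrD(1)[OF \<theta>'(1)] by simp
    show "\<theta>' = \<theta>"
    proof (rule nat_trans_eqI[OF n\<theta>' n\<theta>])
      fix x assume x: "x \<in> Obj ?C"
      have "on_ar P (component \<theta>' x) = component \<gamma> x"
        "cmp E (component \<phi> x) (component \<theta>' x) = component \<psi> x"
        using arg_cong[OF c(1), of "\<lambda>\<alpha>. component \<alpha> x"] arg_cong[OF c(2), of "\<lambda>\<alpha>. component \<alpha> x"] x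
        by auto
      note eq = this
      show "component \<theta>' x = component \<theta> x"
        by (rule cartesian_unique[OF pw[OF x]])
          (use eq x naturalD(3-5)[OF n\<theta>' x] \<theta>'(2,3) in \<open>simp_all add: \<theta>_def \<chi>\<close>)
    qed (use \<theta>' in \<open>simp_all add: \<theta>_def\<close>)
  qed
qed

end

context category_over
begin

lemma grothendieck_fibration_iff:
  "grothendieck_fibration E B P \<longleftrightarrow> (\<forall>e\<in>Obj E. \<forall>f\<in>Arr B. tgt B f = on_ob P e \<longrightarrow>
     (\<exists>\<phi>. cartesian E B P \<phi> \<and> tgt E \<phi> = e \<and> on_ar P \<phi> = f))"
  using P_functor E.category_axioms B.category_axioms by (simp add: grothendieck_fibration_def)

text \<open>
  The source of the lift is defined on arrows by factoring through the chosen Cartesian arrows, and it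
  is a functor because these factorisations are unique.
\<close>

lemma pointwise_cartesian_lift:
  assumes fib: "grothendieck_fibration E B P" and "category C" "is_functor C E F"
    and \<alpha>: "natural C B \<alpha>" "nt_tgt \<alpha> = func_comp C P F"
  obtains \<phi> where "natural C E \<phi>" "nt_tgt \<phi> = F" "whisker_left C P \<phi> = \<alpha>"
    "\<And>c. c \<in> Obj C \<Longrightarrow> cartesian E B P (component \<phi> c)"
proof -
  interpret C: category C by fact
  note [simp] = C.src_Obj C.tgt_Obj C.ident_Arr C.src_ident C.tgt_ident C.cmp_Arr C.src_cmp C.tgt_cmp
    is_functorD(1-6)[OF assms(3)] is_functorD(1-6)[OF naturalD(1)[OF \<alpha>(1)]]
    naturalD(3-5)[OF \<alpha>(1)]
  have "\<exists>\<phi>. cartesian E B P \<phi> \<and> tgt E \<phi> = on_ob F c \<and> on_ar P \<phi> = component \<alpha> c"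
    if "c \<in> Obj C" for c
    using fib that \<alpha>(2) by (simp add: grothendieck_fibration_iff)
  then obtain \<phi> where \<phi>: "\<And>c. c \<in> Obj C \<Longrightarrow> cartesian E B P (\<phi> c)"
    "\<And>c. c \<in> Obj C \<Longrightarrow> tgt E (\<phi> c) = on_ob F c"
    "\<And>c. c \<in> Obj C \<Longrightarrow> on_ar P (\<phi> c) = component \<alpha> c"
    by metis
  note [simp] = cartesian_Arr[OF \<phi>(1)] \<phi>(2,3)
  have Ps: "on_ob P (src E (\<phi> c)) = on_ob (nt_src \<alpha>) c" if "c \<in> Obj C" for c
    using that by (simp flip: is_functorD(3)[OF P_functor])
  have nat: "cmp B (component \<alpha> (tgt C f)) (on_ar (nt_src \<alpha>) f) =
      cmp B (on_ar P (on_ar F f)) (component \<alpha> (src C f))" if "f \<in> Arr C" for f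
    using naturalD(6)[OF \<alpha>(1) that] \<alpha>(2) that by simp
  have "\<exists>\<chi>. \<chi> \<in> Arr E \<and> src E \<chi> = src E (\<phi> (src C f)) \<and> tgt E \<chi> = src E (\<phi> (tgt C f)) \<and>
      on_ar P \<chi> = on_ar (nt_src \<alpha>) f \<and> cmp E (\<phi> (tgt C f)) \<chi> = cmp E (on_ar F f) (\<phi> (src C f))"
    if "f \<in> Arr C" for f
    by (rule cartesian_factor[OF \<phi>(1)[OF C.tgt_Obj[OF that]],
          of "cmp E (on_ar F f) (\<phi> (src C f))" "on_ar (nt_src \<alpha>) f"])
      (use that nat[OF that] in \<open>auto simp: Ps\<close>)
  then obtain h where h: "\<And>f. f \<in> Arr C \<Longrightarrow> h f \<in> Arr E"
    "\<And>f. f \<in> Arr C \<Longrightarrow> src E (h f) = src E (\<phi> (src C f))"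
    "\<And>f. f \<in> Arr C \<Longrightarrow> tgt E (h f) = src E (\<phi> (tgt C f))"
    "\<And>f. f \<in> Arr C \<Longrightarrow> on_ar P (h f) = on_ar (nt_src \<alpha>) f"
    "\<And>f. f \<in> Arr C \<Longrightarrow> cmp E (\<phi> (tgt C f)) (h f) = cmp E (on_ar F f) (\<phi> (src C f))"
    by metis
  note [simp] = h(1-4)
  have h_ident: "h (ident C c) = ident E (src E (\<phi> c))" if c: "c \<in> Obj C" for c
    by (rule cartesian_unique[OF \<phi>(1)[OF c]]) (use c h(5)[OF C.ident_Arr[OF c]] in \<open>simp_all add: Ps\<close>)
  have h_cmp: "h (cmp C g f) = cmp E (h g) (h f)"
    if f: "f \<in> Arr C" and g: "g \<in> Arr C" and c: "src C g = tgt C f" for f g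
  proof (rule cartesian_unique[OF \<phi>(1)[OF C.tgt_Obj[OF g]]])
    have "cmp E (\<phi> (tgt C g)) (h (cmp C g f)) = cmp E (on_ar F g) (cmp E (on_ar F f) (\<phi> (src C f)))"
      using h(5)[OF C.cmp_Arr[OF f g c]] f g c by (simp add: E.cmp_assoc)
    also have "\<dots> = cmp E (cmp E (on_ar F g) (\<phi> (src C g))) (h f)"
      using f g c h(5)[OF f] by (simp flip: E.cmp_assoc)
    also have "\<dots> = cmp E (\<phi> (tgt C g)) (cmp E (h g) (h f))"
      using f g c h(5)[OF g] by (simp add: E.cmp_assoc)
    finally show "cmp E (\<phi> (tgt C g)) (h (cmp C g f)) = cmp E (\<phi> (tgt C g)) (cmp E (h g) (h f))" .
  qed (use f g c in simp_all)
  define H where "H = \<lparr>on_ob = (\<lambda>c\<in>Obj C. src E (\<phi> c)), on_ar = (\<lambda>f\<in>Arr C. h f)\<rparr>"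
  have H: "is_functor C E H"
    unfolding is_functor_def H_def by (auto simp: h_ident h_cmp)
  define \<Phi> where "\<Phi> = \<lparr>nt_src = H, nt_tgt = F, component = (\<lambda>c\<in>Obj C. \<phi> c)\<rparr>"
  have n: "natural C E \<Phi>"
    using H assms(3) h(5) by (auto simp: \<Phi>_def natural_def H_def)
  have PH: "func_comp C P H = nt_src \<alpha>"
    by (rule functor_eqI[OF is_functor_comp[OF assms(2) H P_functor] naturalD(1)[OF \<alpha>(1)]])
      (simp_all add: H_def Ps)
  have "whisker_left C P \<Phi> = \<alpha>"
    using extensionalityI[OF _ naturalD(7)[OF \<alpha>(1)], of "component (whisker_left C P \<Phi>)"] \<alpha>(2) PH
    by (intro nat_trans.equality) (auto simp: \<Phi>_def whisker_left_def)
  then show ?thesis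
    using that[of \<Phi>] n \<phi>(1) by (simp add: \<Phi>_def)
qed

end

lemma covering_function_induced: "covering_function E (induced_covfun E B P K)"
  by (auto simp: covering_function_def is_covering_def induced_covfun_def cartesian_def)

lemma strict_morphism_induced:
  "is_functor E B P \<Longrightarrow> strict_morphism (E, induced_covfun E B P K) (B, K) P"
  by (auto simp: strict_morphism_def induced_covfun_def)

lemma is_iso_component:
  assumes "is_iso (site_hom X Y) \<chi>" "c \<in> Obj (fst X)"
  shows "is_iso (fst Y) (component \<chi> c)"
proof -
  obtain \<chi>' where *: "\<chi> \<in> Arr (site_hom X Y)" "\<chi>' \<in> Arr (site_hom X Y)"
    "nt_src \<chi>' = nt_tgt \<chi>" "nt_tgt \<chi>' = nt_src \<chi>"
    "cmp (site_hom X Y) \<chi>' \<chi> = ident (site_hom X Y) (nt_src \<chi>)"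
    "cmp (site_hom X Y) \<chi> \<chi>' = ident (site_hom X Y) (nt_tgt \<chi>)"
    using assms(1) by (auto simp: is_iso_def)
  note n = naturalD(3-5)[OF site_hom_ArrD(1)[OF *(1)] assms(2)]
    naturalD(3-5)[OF site_hom_ArrD(1)[OF *(2)] assms(2)]
  show ?thesis
    unfolding is_iso_def
    by (intro conjI bexI[of _ "component \<chi>' c"])
      (use n *(3,4) arg_cong[OF *(5), of "\<lambda>\<alpha>. component \<alpha> c"]
        arg_cong[OF *(6), of "\<lambda>\<alpha>. component \<alpha> c"] assms(2) in simp_all)
qed

context site_over
begin

context
  assumes fib: "grothendieck_fibration E B P" and induced: "KE = induced_covfun E B P KB"
begin

text \<open>
  For the induced coverings, the source of a componentwise lift is again a strict morphism. This is where
  it matters that induced coverings consist of Cartesian arrows.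
\<close>

lemma cartesian_lift_strict:
  assumes X: "is_site X" and F: "strict_morphism X (E, KE) F"
    and \<alpha>: "\<alpha> \<in> Arr (hom_B X)" "nt_tgt \<alpha> = func_comp (fst X) P F"
  obtains \<phi> where "\<phi> \<in> Arr (hom_E X)" "nt_tgt \<phi> = F" "whisker_left (fst X) P \<phi> = \<alpha>"
    "\<And>c. c \<in> Obj (fst X) \<Longrightarrow> cartesian E B P (component \<phi> c)"
proof -
  obtain C K where XC: "X = (C, K)" by (cases X)
  interpret C: category C using site_categories[OF X] XC by simp
  have F': "is_functor C E F" using strict_morphism_functor[OF F] XC by simp
  obtain \<phi> where \<phi>: "natural C E \<phi>" "nt_tgt \<phi> = F" "whisker_left C P \<phi> = \<alpha>"
    "\<And>c. c \<in> Obj C \<Longrightarrow> cartesian E B P (component \<phi> c)"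
    using pointwise_cartesian_lift[OF fib C.category_axioms F', of \<alpha>] \<alpha> XC site_hom_ArrD(1)[OF \<alpha>(1)]
    by auto
  let ?H = "nt_src \<phi>"
  have PH: "func_comp C P ?H = nt_src \<alpha>"
    using \<phi>(3) by auto
  note [simp] = naturalD(3-5)[OF \<phi>(1)] is_functorD(1-4)[OF naturalD(1)[OF \<phi>(1)]]
    is_functorD(1-4)[OF F'] C.src_Obj C.tgt_Obj
  have "on_ar ?H ` R \<in> KE (on_ob ?H c)" if c: "c \<in> Obj C" and R: "R \<in> K c" for c R
  proof -
    have RA: "R \<subseteq> {f \<in> Arr C. tgt C f = c}"
      using X c R by (auto simp: XC is_site_def covering_function_def is_covering_def)
    have "on_ar F ` R \<in> KE (on_ob F c)"
      using F c R by (simp add: XC strict_morphism_def)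
    then have cF: "cartesian E B P (on_ar F f)" if "f \<in> R" for f
      using that by (auto simp: induced induced_covfun_def)
    have "cartesian E B P (on_ar ?H f)" if f: "f \<in> R" for f
      \<comment> \<open>the naturality square at \<open>f\<close>, read from its Cartesian side\<close>
    proof (rule cartesian_cancel[OF \<phi>(4)])
      show "c \<in> Obj C" by (rule c)
      have fC: "f \<in> Arr C" "tgt C f = c" using RA f by auto
      then have "cmp E (component \<phi> c) (on_ar ?H f) = cmp E (on_ar F f) (component \<phi> (src C f))"
        using naturalD(6)[OF \<phi>(1), of f] \<phi>(2) by auto
      then show "cartesian E B P (cmp E (component \<phi> c) (on_ar ?H f))"
        using cartesian_comp[OF cF[OF f] \<phi>(4)[of "src C f"]] fC \<phi>(2) by simp
    qed (use RA f in auto)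
    moreover have "on_ar P ` on_ar ?H ` R = on_ar (nt_src \<alpha>) ` R"
      unfolding PH[symmetric] image_image using RA by (intro image_cong) auto
    moreover have "on_ar (nt_src \<alpha>) ` R \<in> KB (on_ob (nt_src \<alpha>) c)"
      using site_hom_ArrD(2)[OF \<alpha>(1)] c R by (simp add: XC strict_morphism_def)
    moreover have "on_ob (nt_src \<alpha>) c = on_ob P (on_ob ?H c)"
      unfolding PH[symmetric] using c by simp
    ultimately show ?thesis
      using RA by (auto simp: induced induced_covfun_def)
  qed
  then have "strict_morphism X (E, KE) ?H"
    using naturalD(1)[OF \<phi>(1)] by (simp add: XC strict_morphism_def)
  then have "\<phi> \<in> Arr (hom_E X)"
    using \<phi> F by (simp add: XC site_hom_ArrI)
  with \<phi> that show ?thesis by (simp add: XC)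
qed

lemma grothendieck_fibration_post:
  assumes X: "is_site X"
  shows "grothendieck_fibration (hom_E X) (hom_B X) (post X)"
proof -
  interpret X: category_over "hom_E X" "hom_B X" "post X"
    using X by (rule category_over_hom)
  show ?thesis
    unfolding X.grothendieck_fibration_iff
  proof (intro ballI impI)
    fix F \<alpha> assume "F \<in> Obj (hom_E X)" and \<alpha>: "\<alpha> \<in> Arr (hom_B X)" "tgt (hom_B X) \<alpha> = on_ob (post X) F"
    then have F: "strict_morphism X (E, KE) F" by simp
    obtain \<phi> where \<phi>: "\<phi> \<in> Arr (hom_E X)" "nt_tgt \<phi> = F" "whisker_left (fst X) P \<phi> = \<alpha>"
      "\<And>c. c \<in> Obj (fst X) \<Longrightarrow> cartesian E B P (component \<phi> c)"
      by (rule cartesian_lift_strict[OF X F \<alpha>(1)]) (use \<alpha>(2) F in auto)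
    then show "\<exists>\<phi>. cartesian (hom_E X) (hom_B X) (post X) \<phi> \<and> tgt (hom_E X) \<phi> = F \<and>
        on_ar (post X) \<phi> = \<alpha>"
      using pointwise_cartesian_imp_cartesian[OF X \<phi>(1,4)] by auto
  qed
qed

text \<open>
  A Cartesian 2-cell differs from a componentwise Cartesian lift of the same 2-cell by an isomorphism,
  and isomorphisms are Cartesian in each component.
\<close>

lemma cartesian_imp_pointwise_cartesian:
  assumes X: "is_site X" and c: "cartesian (hom_E X) (hom_B X) (post X) \<phi>" and x: "x \<in> Obj (fst X)"
  shows "cartesian E B P (component \<phi> x)"
proof -
  interpret X: category_over "hom_E X" "hom_B X" "post X"
    using X by (rule category_over_hom)
  note \<phi> = X.cartesian_Arr[OF c]
  have p\<phi>: "whisker_left (fst X) P \<phi> \<in> Arr (hom_B X)"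
    using is_functorD(2)[OF X.P_functor \<phi>] \<phi> by simp
  obtain \<psi> where \<psi>: "\<psi> \<in> Arr (hom_E X)" "nt_tgt \<psi> = nt_tgt \<phi>"
    "whisker_left (fst X) P \<psi> = whisker_left (fst X) P \<phi>"
    "\<And>c. c \<in> Obj (fst X) \<Longrightarrow> cartesian E B P (component \<psi> c)"
    by (rule cartesian_lift_strict[OF X site_hom_ArrD(3)[OF \<phi>] p\<phi>]) simp_all
  obtain \<chi> where \<chi>: "is_iso (hom_E X) \<chi>" "nt_tgt \<chi> = nt_src \<psi>" "cmp (hom_E X) \<psi> \<chi> = \<phi>"
    using X.cartesian_comparison[OF c pointwise_cartesian_imp_cartesian[OF X \<psi>(1,4)]] \<psi> \<phi> by auto
  have i: "is_iso E (component \<chi> x)"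
    using is_iso_component[OF \<chi>(1) x] by simp
  have "\<chi> \<in> Arr (hom_E X)" using \<chi>(1) by (simp add: is_iso_def)
  then have "src E (component \<psi> x) = tgt E (component \<chi> x)"
    using naturalD(4)[OF site_hom_ArrD(1)[OF \<psi>(1)] x] naturalD(5)[OF site_hom_ArrD(1) x] \<chi>(2) by force
  then have "cartesian E B P (cmp E (component \<psi> x) (component \<chi> x))"
    by (rule cartesian_comp[OF \<psi>(4)[OF x] iso_cartesian[OF i]])
  then show ?thesis
    using arg_cong[OF \<chi>(3), of "\<lambda>\<alpha>. component \<alpha> x"] x by simp
qed

lemma internal_fibration_induced: "internal_fibration SITEs (E, KE) (B, KB) P"
  unfolding internal_fibration_def
proof (intro conjI ballI allI impI)
  fix X Y F \<phi>
  assume "X \<in> Obj2 SITEs" "Y \<in> Obj2 SITEs" "F \<in> Obj (Hom2 SITEs X Y)"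
    and "cartesian (Hom2 SITEs Y (E, KE)) (Hom2 SITEs Y (B, KB)) (post Y) \<phi>"
  then have X: "is_site X" and Y: "is_site Y" and F: "strict_morphism X Y F"
    and c: "cartesian (hom_E Y) (hom_B Y) (post Y) \<phi>"
    by (simp_all add: SITEs_def)
  interpret S: two_category SITEs by (rule two_category_SITEs)
  note \<phi> = category_over.cartesian_Arr[OF category_over_hom[OF Y] c]
  have F': "is_functor (fst X) (fst Y) F" using F by (rule strict_morphism_functor)
  have eq: "on_ar (precomp SITEs X Y (E, KE) F) \<phi> = whisker_right (fst X) \<phi> F"
    by (rule on_ar_precomp_SITEs) (use E.category_axioms F' \<phi> in auto)
  have "ident (site_hom X Y) F \<in> Arr (site_hom X Y)"
    using category.ident_Arr[OF category_site_hom[OF X Y]] F by simp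
  then have w: "on_ar (precomp SITEs X Y (E, KE) F) \<phi> \<in> Arr (hom_E X)"
    using S.hcomp_Arr[of X Y "(E, KE)"] X Y site_E \<phi> by (simp add: precomp_def SITEs_def)
  have "cartesian (hom_E X) (hom_B X) (post X) (whisker_right (fst X) \<phi> F)"
    by (rule pointwise_cartesian_imp_cartesian[OF X])
      (use w[unfolded eq] is_functorD(1)[OF F'] cartesian_imp_pointwise_cartesian[OF Y c] in auto)
  then show "cartesian (Hom2 SITEs X (E, KE)) (Hom2 SITEs X (B, KB)) (post X)
      (on_ar (precomp SITEs X Y (E, KE) F) \<phi>)"
    unfolding eq by (simp add: SITEs_def)
qed (use site_E site_B P_strict grothendieck_fibration_post in \<open>simp_all add: SITEs_def\<close>)

end

end

section \<open>The one-point site\<close>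

definition point_cat :: "('o, 'a) category" where
  "point_cat = \<lparr>Obj = {undefined}, Arr = {undefined}, src = (\<lambda>_. undefined), tgt = (\<lambda>_. undefined),
     ident = (\<lambda>_. undefined), cmp = (\<lambda>_ _. undefined)\<rparr>"

text \<open>
  With no coverings to preserve, every functor out of this site is strict.
\<close>

abbreviation point_site :: "('o, 'a) site" where
  "point_site \<equiv> (point_cat, \<lambda>_. {})"

definition point_functor :: "('p, 'b) category \<Rightarrow> 'p \<Rightarrow> ('o, 'a, 'p, 'b) func" where
  "point_functor D d = \<lparr>on_ob = (\<lambda>_\<in>{undefined}. d), on_ar = (\<lambda>_\<in>{undefined}. ident D d)\<rparr>"

definition point_nat_trans :: "('p, 'b) category \<Rightarrow> 'b \<Rightarrow> ('o, 'a, 'p, 'b) nat_trans" where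
  "point_nat_trans D f = \<lparr>nt_src = point_functor D (src D f), nt_tgt = point_functor D (tgt D f),
     component = (\<lambda>_\<in>{undefined}. f)\<rparr>"

lemma point_cat_simps [simp]:
  "Obj point_cat = {undefined}" "Arr point_cat = {undefined}" "src point_cat f = undefined"
  "tgt point_cat f = undefined" "ident point_cat c = undefined" "cmp point_cat g f = undefined"
  by (simp_all add: point_cat_def)

lemma point_functor_simps [simp]:
  "on_ob (point_functor D d) undefined = d" "on_ar (point_functor D d) undefined = ident D d"
  by (simp_all add: point_functor_def)

lemma point_nat_trans_simps [simp]:
  "nt_src (point_nat_trans D f) = point_functor D (src D f)"
  "nt_tgt (point_nat_trans D f) = point_functor D (tgt D f)"
  "component (point_nat_trans D f) undefined = f"
  by (simp_all add: point_nat_trans_def)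

lemma is_site_point: "is_site point_site"
  by (auto simp: is_site_def covering_function_def intro!: category.intro)

lemma strict_morphism_point_iff:
  "strict_morphism point_site (D, K) F \<longleftrightarrow> is_functor point_cat D F"
  by (simp add: strict_morphism_def)

lemma is_functor_point:
  assumes "category D" "d \<in> Obj D"
  shows "is_functor point_cat D (point_functor D d)"
proof -
  interpret D: category D by fact
  show ?thesis
    using assms(2) D.cmp_ident_left[of "ident D d"]
    by (auto simp: is_functor_def point_functor_def D.ident_Arr D.src_ident D.tgt_ident)
qed

lemma functor_on_point:
  assumes "is_functor point_cat D F"
  shows "F = point_functor D (on_ob F undefined)"
proof -
  have "x = undefined \<longrightarrow> on_ar F x = ident D (on_ob F undefined)" for x
    using is_functorD(5)[OF assms, of undefined] by simp
  then show ?thesis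
    using is_functorD(7,8)[OF assms]
    by (intro func.equality) (auto simp: point_functor_def fun_eq_iff extensional_def)
qed

lemma natural_point:
  assumes "category D" "f \<in> Arr D"
  shows "natural point_cat D (point_nat_trans D f)"
proof -
  interpret D: category D by fact
  show ?thesis
    using assms
    by (auto simp: natural_def is_functor_point D.src_Obj D.tgt_Obj D.cmp_ident_left D.cmp_ident_right
        point_nat_trans_def)
qed

lemma natural_on_point:
  assumes "natural point_cat D \<alpha>"
  shows "\<alpha> = point_nat_trans D (component \<alpha> undefined)"
  using naturalD(3-5,7)[OF assms] functor_on_point[OF naturalD(1)[OF assms]]
    functor_on_point[OF naturalD(2)[OF assms]]
  by (intro nat_trans.equality) (auto simp: point_nat_trans_def fun_eq_iff extensional_def)

context site_over
begin

lemma point_Arr_iff: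
  "\<alpha> \<in> Arr (hom_E point_site) \<longleftrightarrow> natural point_cat E \<alpha>"
  "\<beta> \<in> Arr (hom_B point_site) \<longleftrightarrow> natural point_cat B \<beta>"
  by (auto simp: site_hom_def strict_morphism_point_iff dest: naturalD(1,2))

lemma post_point:
  "e \<in> Obj E \<Longrightarrow> func_comp point_cat P (point_functor E e) = point_functor B (on_ob P e)"
  "f \<in> Arr E \<Longrightarrow> whisker_left point_cat P (point_nat_trans E f) = point_nat_trans B (on_ar P f)"
proof -
  show *: "func_comp point_cat P (point_functor E e) = point_functor B (on_ob P e)"
    if "e \<in> Obj E" for e
    using that by (auto simp: func_comp_def point_functor_def compose_def fun_eq_iff)
  show "whisker_left point_cat P (point_nat_trans E f) = point_nat_trans B (on_ar P f)"
    if "f \<in> Arr E" for f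
    using that by (auto simp: whisker_left_def point_nat_trans_def * fun_eq_iff)
qed

text \<open>
  Evaluation at the point identifies the functor \<^term>\<open>post point_site\<close> with \<^term>\<open>P\<close>, so a
  factorisation problem for the component is one for the 2-cell.
\<close>

lemma cartesian_point:
  assumes c: "cartesian (hom_E point_site) (hom_B point_site) (post point_site) \<phi>"
  shows "cartesian E B P (component \<phi> undefined)"
proof -
  interpret X: category_over "hom_E point_site" "hom_B point_site" "post point_site"
    by (rule category_over_hom[OF is_site_point])
  have n\<phi>: "natural point_cat E \<phi>"
    using X.cartesian_Arr[OF c] by (simp add: point_Arr_iff)
  define p where "p = component \<phi> undefined"
  have p: "p \<in> Arr E" using naturalD(3)[OF n\<phi>] by (simp add: p_def)
  have \<phi>: "\<phi> = point_nat_trans E p" unfolding p_def by (rule natural_on_point[OF n\<phi>])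
  have "cartesian E B P p"
    unfolding cartesian_def
  proof (intro conjI ballI impI)
    fix \<psi> g assume \<psi>: "\<psi> \<in> Arr E" and g: "g \<in> Arr B"
      and eq: "tgt E \<psi> = tgt E p \<and> src B g = on_ob P (src E \<psi>) \<and> tgt B g = on_ob P (src E p) \<and>
        cmp B (on_ar P p) g = on_ar P \<psi>"
    let ?\<Psi> = "point_nat_trans E \<psi> :: ('o, 'a, 'o, 'a) nat_trans"
      and ?G = "point_nat_trans B g :: ('o, 'a, 'o, 'a) nat_trans"
    have \<Psi>: "?\<Psi> \<in> Arr (hom_E point_site)" and G: "?G \<in> Arr (hom_B point_site)"
      using natural_point \<psi> g E.category_axioms B.category_axioms by (auto simp: point_Arr_iff)
    have P\<phi>: "on_ar (post point_site) \<phi> = point_nat_trans B (on_ar P p)"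
      using X.cartesian_Arr[OF c] p by (simp add: \<phi> post_point)
    have P\<Psi>: "on_ar (post point_site) ?\<Psi> = point_nat_trans B (on_ar P \<psi>)"
      using \<Psi> \<psi> by (simp add: post_point)
    have cmp: "cmp (site_hom point_site (D, K)) (point_nat_trans D k) (point_nat_trans D h) =
        point_nat_trans D (cmp D k h)"
      if "category D" "h \<in> Arr D" "k \<in> Arr D" "src D k = tgt D h"
      for D :: "('o, 'a) category" and K and h k
      using that by (auto simp: site_hom_def point_nat_trans_def category.src_cmp category.tgt_cmp fun_eq_iff)
    have "\<exists>!\<chi>. \<chi> \<in> Arr (hom_E point_site) \<and> src (hom_E point_site) \<chi> = src (hom_E point_site) ?\<Psi> \<and>
        tgt (hom_E point_site) \<chi> = src (hom_E point_site) \<phi> \<and>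
        on_ar (post point_site) \<chi> = ?G \<and> cmp (hom_E point_site) \<phi> \<chi> = ?\<Psi>"
    proof (rule X.cartesian_ex1[OF c \<Psi> G])
      show "cmp (hom_B point_site) (on_ar (post point_site) \<phi>) ?G = on_ar (post point_site) ?\<Psi>"
        unfolding P\<phi> P\<Psi> using eq g p by (simp add: cmp[OF B.category_axioms])
    qed (use eq p \<psi> g in \<open>auto simp: \<phi> post_point strict_morphism_point_iff is_functor_point E.category_axioms\<close>)
    then obtain \<chi> where \<chi>: "\<chi> \<in> Arr (hom_E point_site)" "nt_src \<chi> = nt_src ?\<Psi>"
        "nt_tgt \<chi> = nt_src \<phi>" "on_ar (post point_site) \<chi> = ?G" "cmp (hom_E point_site) \<phi> \<chi> = ?\<Psi>"
      and uniq: "\<And>\<chi>'. \<chi>' \<in> Arr (hom_E point_site) \<Longrightarrow> nt_src \<chi>' = nt_src ?\<Psi> \<Longrightarrow>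
        nt_tgt \<chi>' = nt_src \<phi> \<Longrightarrow> on_ar (post point_site) \<chi>' = ?G \<Longrightarrow>
        cmp (hom_E point_site) \<phi> \<chi>' = ?\<Psi> \<Longrightarrow> \<chi>' = \<chi>"
      unfolding site_hom_simps by (elim ex1E conjE) blast
    note n = naturalD(3-5)[OF \<chi>(1)[unfolded point_Arr_iff], of undefined]
    show "\<exists>!\<chi>. \<chi> \<in> Arr E \<and> src E \<chi> = src E \<psi> \<and> tgt E \<chi> = src E p \<and> on_ar P \<chi> = g \<and> cmp E p \<chi> = \<psi>"
    proof (rule ex1I[of _ "component \<chi> undefined"], goal_cases)
      case 1
      have "on_ar P (component \<chi> undefined) = g"
        using arg_cong[OF \<chi>(4), of "\<lambda>\<alpha>. component \<alpha> undefined"] \<chi>(1) by simp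
      moreover have "cmp E p (component \<chi> undefined) = \<psi>"
        using arg_cong[OF \<chi>(5), of "\<lambda>\<alpha>. component \<alpha> undefined"] by (simp add: \<phi>)
      ultimately show ?case using n \<chi>(2,3) \<phi> by simp
    next
      case (2 x)
      then have x: "x \<in> Arr E" "src E x = src E \<psi>" "tgt E x = src E p" "on_ar P x = g"
        "cmp E p x = \<psi>" by auto
      have "(point_nat_trans E x :: ('o, 'a, 'o, 'a) nat_trans) = \<chi>"
        by (rule uniq) (use x p in \<open>simp_all add: \<phi> point_Arr_iff post_point
          cmp[OF E.category_axioms] natural_point[OF E.category_axioms]\<close>)
      then show ?case by (metis point_nat_trans_simps(3))
    qed
  qed (rule p)
  then show ?thesis by (simp add: p_def)
qed

lemma internal_fibration_imp_fibration:
  assumes i: "internal_fibration SITEs (E, KE) (B, KB) P"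
  shows "grothendieck_fibration E B P"
  unfolding grothendieck_fibration_iff
proof (intro ballI impI)
  interpret X: category_over "hom_E point_site" "hom_B point_site" "post point_site"
    by (rule category_over_hom[OF is_site_point])
  fix e f assume e: "e \<in> Obj E" and f: "f \<in> Arr B" and t: "tgt B f = on_ob P e"
  have "grothendieck_fibration (hom_E point_site) (hom_B point_site) (post point_site)"
    using internal_fibrationD(1)[OF i is_site_point] .
  moreover have "point_functor E e \<in> Obj (hom_E point_site)"
    using e E.category_axioms by (simp add: strict_morphism_point_iff is_functor_point)
  moreover have "point_nat_trans B f \<in> Arr (hom_B point_site)"
    using f B.category_axioms by (simp add: point_Arr_iff natural_point)
  moreover have "tgt (hom_B point_site) (point_nat_trans B f) =
      on_ob (post point_site) (point_functor E e)"
    using e t E.category_axioms by (simp add: strict_morphism_point_iff is_functor_point post_point)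
  ultimately obtain \<phi> where \<phi>: "cartesian (hom_E point_site) (hom_B point_site) (post point_site) \<phi>"
    "nt_tgt \<phi> = point_functor E e" "on_ar (post point_site) \<phi> = point_nat_trans B f"
    unfolding X.grothendieck_fibration_iff by (metis site_hom_simps(3))
  have A: "\<phi> \<in> Arr (hom_E point_site)" using \<phi>(1) by (rule X.cartesian_Arr)
  have "tgt E (component \<phi> undefined) = e"
    using naturalD(5)[OF A[unfolded point_Arr_iff], of undefined] \<phi>(2) by simp
  moreover have "on_ar P (component \<phi> undefined) = f"
    using arg_cong[OF \<phi>(3), of "\<lambda>\<alpha>. component \<alpha> undefined"] A by simp
  ultimately show "\<exists>\<phi>. cartesian E B P \<phi> \<and> tgt E \<phi> = e \<and> on_ar P \<phi> = f"
    using cartesian_point[OF \<phi>(1)] by blast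
qed

text \<open>
  The component at an object is the restriction along the corresponding morphism from the one-point
  site, and restriction preserves Cartesian 2-cells by the second condition on an internal fibration.
\<close>

lemma internal_fibration_imp_pointwise_cartesian:
  assumes i: "internal_fibration SITEs (E, KE) (B, KB) P"
    and X: "is_site X" and c: "cartesian (hom_E X) (hom_B X) (post X) \<phi>" and x: "x \<in> Obj (fst X)"
  shows "cartesian E B P (component \<phi> x)"
proof -
  let ?x = "point_functor (fst X) x"
  have \<phi>: "\<phi> \<in> Arr (hom_E X)"
    using category_over.cartesian_Arr[OF category_over_hom[OF X] c] .
  have x': "strict_morphism point_site X ?x"
    using is_functor_point[OF site_categories[OF X] x]
    by (cases X) (simp add: strict_morphism_point_iff)
  have "on_ar (precomp SITEs point_site X (E, KE) ?x) \<phi> = whisker_right point_cat \<phi> ?x"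
    using on_ar_precomp_SITEs[of "(E, KE)" point_site X ?x \<phi>] E.category_axioms \<phi>
      strict_morphism_functor[OF x'] by simp
  moreover have "cartesian (hom_E point_site) (hom_B point_site) (post point_site)
      (on_ar (precomp SITEs point_site X (E, KE) ?x) \<phi>)"
    using internal_fibrationD(2)[OF i is_site_point X x' c] .
  ultimately show ?thesis
    using cartesian_point[of "whisker_right point_cat \<phi> ?x"] by simp
qed

end

section \<open>Cone-shaped sites\<close>

lemma ex_inj_sum_option: "\<exists>h :: 'u::infinite + 'u option \<Rightarrow> 'u. inj h"
proof -
  have "\<exists>g. bij_betw g (UNIV <+> UNIV :: ('u + 'u) set) (UNIV :: 'u set)"
    unfolding card_of_ordIso by (rule card_of_Plus_infinite1) (simp_all add: infinite_UNIV card_of_mono1)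
  then obtain g :: "'u + 'u \<Rightarrow> 'u" where "bij g"
    by auto
  then have g: "g x = g y \<longleftrightarrow> x = y" for x y
    by (metis bij_def inj_eq)
  let ?h = "\<lambda>x. case x of Inl s \<Rightarrow> g (Inl s) | Inr None \<Rightarrow> g (Inr (g (Inl undefined)))
    | Inr (Some s) \<Rightarrow> g (Inr (g (Inr s)))"
  have "inj ?h"
    by (rule injI) (auto simp: g split: sum.splits option.splits)
  then show ?thesis by blast
qed

text \<open>
  A test site must have its objects and arrows in the given infinite type. The cone over a set of
  arrows needs an apex, and for each member of the set both an object and an arrow, which this injection
  supplies. In the cone an object doubles as its own identity arrow.
\<close>

definition cone_code :: "'u::infinite + 'u option \<Rightarrow> 'u" where
  "cone_code = (SOME h. inj h)"

abbreviation apex :: "'u::infinite" where "apex \<equiv> cone_code (Inr None)"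
abbreviation base :: "'u::infinite \<Rightarrow> 'u" where "base s \<equiv> cone_code (Inr (Some s))"
abbreviation leg :: "'u::infinite \<Rightarrow> 'u" where "leg s \<equiv> cone_code (Inl s)"

lemma inj_cone_code: "inj cone_code"
  unfolding cone_code_def by (rule someI_ex[OF ex_inj_sum_option])

lemma cone_code_simps [simp]: "cone_code x = cone_code y \<longleftrightarrow> x = y" "inv cone_code (cone_code x) = x"
  by (simp_all add: inj_eq[OF inj_cone_code] inv_f_f[OF inj_cone_code])

definition cone_cat :: "'u::infinite set \<Rightarrow> ('u, 'u) category" where
  "cone_cat S = \<lparr>Obj = insert apex (base ` S), Arr = insert apex (base ` S \<union> leg ` S),
     src = (\<lambda>a. case inv cone_code a of Inl s \<Rightarrow> base s | Inr _ \<Rightarrow> a),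
     tgt = (\<lambda>a. case inv cone_code a of Inl s \<Rightarrow> apex | Inr _ \<Rightarrow> a),
     ident = (\<lambda>x. x),
     cmp = (\<lambda>g f. case inv cone_code f of Inl _ \<Rightarrow> f | Inr _ \<Rightarrow> g)\<rparr>"

definition cone_cov :: "'u::infinite set \<Rightarrow> ('u, 'u) covfun" where
  "cone_cov S x = (if x = apex then {leg ` S} else {})"

text \<open>
  A family \<^term>\<open>u\<close> of arrows with common target \<^term>\<open>d\<close>, displayed as the images of the legs
  of the cone.
\<close>

definition cone_functor ::
  "'u::infinite set \<Rightarrow> ('p, 'b) category \<Rightarrow> 'p \<Rightarrow> ('u \<Rightarrow> 'b) \<Rightarrow> ('u, 'u, 'p, 'b) func" where
  "cone_functor S D d u =
     \<lparr>on_ob = (\<lambda>x\<in>Obj (cone_cat S). case inv cone_code x of Inr (Some s) \<Rightarrow> src D (u s) | _ \<Rightarrow> d),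
      on_ar = (\<lambda>a\<in>Arr (cone_cat S). case inv cone_code a of Inl s \<Rightarrow> u s
        | Inr None \<Rightarrow> ident D d | Inr (Some s) \<Rightarrow> ident D (src D (u s)))\<rparr>"

lemma cone_cat_simps [simp]:
  "Obj (cone_cat S) = insert apex (base ` S)"
  "Arr (cone_cat S) = insert apex (base ` S \<union> leg ` S)"
  "src (cone_cat S) apex = apex" "src (cone_cat S) (base s) = base s" "src (cone_cat S) (leg s) = base s"
  "tgt (cone_cat S) apex = apex" "tgt (cone_cat S) (base s) = base s" "tgt (cone_cat S) (leg s) = apex"
  "ident (cone_cat S) x = x"
  "cmp (cone_cat S) g apex = g" "cmp (cone_cat S) g (base s) = g" "cmp (cone_cat S) g (leg s) = leg s"
  by (simp_all add: cone_cat_def)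

lemma cone_functor_simps [simp]:
  "on_ob (cone_functor S D d u) apex = d"
  "s \<in> S \<Longrightarrow> on_ob (cone_functor S D d u) (base s) = src D (u s)"
  "on_ar (cone_functor S D d u) apex = ident D d"
  "s \<in> S \<Longrightarrow> on_ar (cone_functor S D d u) (base s) = ident D (src D (u s))"
  "s \<in> S \<Longrightarrow> on_ar (cone_functor S D d u) (leg s) = u s"
  by (simp_all add: cone_functor_def)

lemma is_site_cone: "is_site (cone_cat S, cone_cov S)"
proof -
  have "category (cone_cat S)"
    by unfold_locales auto
  then show ?thesis
    by (auto simp: is_site_def covering_function_def is_covering_def cone_cov_def)
qed

lemma strict_morphism_cone:
  assumes "is_site (D, K)" "d \<in> Obj D" "\<And>s. s \<in> S \<Longrightarrow> u s \<in> Arr D \<and> tgt D (u s) = d"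
    and "u ` S \<in> K d"
  shows "strict_morphism (cone_cat S, cone_cov S) (D, K) (cone_functor S D d u)"
proof -
  interpret D: category D using assms(1) by (simp add: is_site_def)
  note [simp] = D.src_Obj D.ident_Arr D.src_ident D.tgt_ident assms(2,3)
  have l: "cmp D (ident D (tgt D f)) f = f" if "f \<in> Arr D" for f
    using that by (rule D.cmp_ident_left)
  have i: "cmp D (ident D x) (ident D x) = ident D x" if "x \<in> Obj D" for x
    using l[of "ident D x"] that by simp
  have "cmp D (ident D d) (u s) = u s" "cmp D (u s) (ident D (src D (u s))) = u s" if "s \<in> S" for s
    using l[of "u s"] D.cmp_ident_right[of "u s"] that by auto
  moreover have "on_ob (cone_functor S D d u) \<in> Obj (cone_cat S) \<rightarrow>\<^sub>E Obj D"
    "on_ar (cone_functor S D d u) \<in> Arr (cone_cat S) \<rightarrow>\<^sub>E Arr D"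
    by (auto simp: PiE_iff) (auto simp: cone_functor_def)
  ultimately have "is_functor (cone_cat S) D (cone_functor S D d u)"
    unfolding is_functor_def by (simp add: i ball_Un)
  moreover have "on_ar (cone_functor S D d u) ` leg ` S = u ` S"
    unfolding image_image by (intro image_cong) auto
  ultimately show ?thesis
    using assms(4) by (auto simp: strict_morphism_def cone_cov_def)
qed

section \<open>Coverings of an internal fibration\<close>

lemma refines_trans:
  assumes "category C" "S \<subseteq> Arr C" "refines C R S" "refines C S T" "T \<subseteq> Arr C"
  shows "refines C R T"
proof -
  interpret C: category C by fact
  show ?thesis
    unfolding refines_def
  proof
    fix f assume "f \<in> R"
    then obtain g h where g: "g \<in> S" and h: "h \<in> Arr C" "src C h = src C f" "tgt C h = src C g"
      "f = cmp C g h"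
      using assms(3) by (auto simp: refines_def)
    obtain g' h' where g': "g' \<in> T" and h': "h' \<in> Arr C" "src C h' = src C g" "tgt C h' = src C g'"
      "g = cmp C g' h'"
      using assms(4) g by (auto simp: refines_def)
    have "f = cmp C g' (cmp C h' h)"
      using h h' g' assms(5) by (auto simp: C.cmp_assoc)
    then show "\<exists>g\<in>T. \<exists>h\<in>Arr C. src C h = src C f \<and> tgt C h = src C g \<and> f = cmp C g h"
      using g' h h'
      by (intro bexI[of _ g'] bexI[of _ "cmp C h' h"]) (simp_all add: C.cmp_Arr C.src_cmp C.tgt_cmp)
  qed
qed

context category_over
begin

text \<open>
  The factorisations are the ones lying over identities.
\<close>

lemma refines_of_cartesian:
  assumes "\<And>\<psi>. \<psi> \<in> T \<Longrightarrow> \<exists>\<phi>\<in>S. cartesian E B P \<phi> \<and> \<psi> \<in> Arr E \<and> tgt E \<psi> = tgt E \<phi> \<and>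
    on_ar P \<psi> = on_ar P \<phi>"
  shows "refines E T S"
  unfolding refines_def
proof
  fix \<psi> assume "\<psi> \<in> T"
  then obtain \<phi> where \<phi>: "\<phi> \<in> S" "cartesian E B P \<phi>" and \<psi>: "\<psi> \<in> Arr E" "tgt E \<psi> = tgt E \<phi>"
    "on_ar P \<psi> = on_ar P \<phi>"
    using assms by blast
  note [simp] = cartesian_Arr[OF \<phi>(2)]
  let ?b = "ident B (on_ob P (src E \<psi>))"
  have b: "on_ob P (src E \<psi>) = on_ob P (src E \<phi>)"
    using \<psi> by (simp flip: is_functorD(3)[OF P_functor])
  obtain \<chi> where "\<chi> \<in> Arr E" "src E \<chi> = src E \<psi>" "tgt E \<chi> = src E \<phi>" "cmp E \<phi> \<chi> = \<psi>"
    by (rule cartesian_factor[OF \<phi>(2) \<psi>(1), of ?b]) (use \<psi> b in auto)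
  then show "\<exists>g\<in>S. \<exists>h\<in>Arr E. src E h = src E \<psi> \<and> tgt E h = src E g \<and> \<psi> = cmp E g h"
    using \<phi>(1) by blast
qed

end

locale internal_fibration_of_sites = site_over E B P KE KB
  for E B :: "('u::infinite, 'u) category" and P KE KB +
  assumes internal: "internal_fibration SITEs (E, KE) (B, KB) P"
begin

text \<open>
  The arrows \<^term>\<open>h s\<close> are the legs of a cone obtained by lifting a 2-cell into a
  constant cone; strictness of the lifted morphism is what makes them a covering. Nonemptiness of
  \<^term>\<open>S\<close> enters because the constant morphism sends the covering of the apex to the singleton of an
  identity only if that covering has a member.
\<close>

lemma lift_of_induced_covering:
  assumes M': "axiom_M' E KE" and e: "e \<in> Obj E" and S: "S \<in> induced_covfun E B P KB e" "S \<noteq> {}"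
  obtains \<theta> h where "is_iso E \<theta>" "tgt E \<theta> = e" "h ` S \<in> KE (src E \<theta>)"
    "\<And>s. s \<in> S \<Longrightarrow> h s \<in> Arr E \<and> tgt E (h s) = src E \<theta> \<and> on_ar P (cmp E \<theta> (h s)) = on_ar P s"
proof -
  have Sc: "cartesian E B P s" "tgt E s = e" if "s \<in> S" for s
    using S that by (auto simp: induced_covfun_def)
  have PS: "on_ar P ` S \<in> KB (on_ob P e)"
    using S by (simp add: induced_covfun_def)
  note [simp] = e Sc(2) cartesian_Arr[OF Sc(1)]
  let ?C = "cone_cat S" and ?X = "(cone_cat S, cone_cov S)"
  let ?G = "cone_functor S B (on_ob P e) (on_ar P)" and ?F = "cone_functor S E e (\<lambda>_. ident E e)"
  interpret C: category ?C using site_categories[OF is_site_cone[of S]] by simp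
  interpret X: category_over "hom_E ?X" "hom_B ?X" "post ?X"
    by (rule category_over_hom[OF is_site_cone])
  have G: "strict_morphism ?X (B, KB) ?G"
    by (rule strict_morphism_cone[OF site_B]) (use PS in auto)
  have "(\<lambda>_. ident E e) ` S = {ident E e}" using S(2) by auto
  then have F: "strict_morphism ?X (E, KE) ?F"
    using M' e by (intro strict_morphism_cone[OF site_E]) (auto simp: axiom_M'_def)
  have PF: "strict_morphism ?X (B, KB) (func_comp ?C P ?F)"
    using strict_morphism_comp[OF is_site_cone F P_strict] by simp
  \<comment> \<open>the 2-cell from \<open>?G\<close> to the constant cone, given by the displayed arrows themselves\<close>
  define \<alpha> where "\<alpha> = \<lparr>nt_src = ?G, nt_tgt = func_comp ?C P ?F,
    component = (\<lambda>x\<in>Obj ?C. case inv cone_code x of Inr (Some s) \<Rightarrow> on_ar P s | _ \<Rightarrow> ident B (on_ob P e))\<rparr>"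
  have \<alpha>_simps [simp]: "nt_src \<alpha> = ?G" "nt_tgt \<alpha> = func_comp ?C P ?F"
    "component \<alpha> apex = ident B (on_ob P e)"
    "\<And>s. s \<in> S \<Longrightarrow> component \<alpha> (base s) = on_ar P s"
    by (simp_all add: \<alpha>_def)
  have "component \<alpha> \<in> Obj ?C \<rightarrow>\<^sub>E Arr B"
    by (auto simp: PiE_iff) (auto simp: \<alpha>_def)
  then have "natural ?C B \<alpha>"
    using strict_morphism_functor[OF G] strict_morphism_functor[OF PF]
    by (auto simp: natural_def)
  then have \<alpha>: "\<alpha> \<in> Arr (hom_B ?X)"
    using G PF by (intro site_hom_ArrI) simp_all
  have "grothendieck_fibration (hom_E ?X) (hom_B ?X) (post ?X)"
    by (rule internal_fibrationD(1)[OF internal is_site_cone])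
  then obtain \<phi> where c: "cartesian (hom_E ?X) (hom_B ?X) (post ?X) \<phi>"
    and t: "nt_tgt \<phi> = ?F" and p: "on_ar (post ?X) \<phi> = \<alpha>"
    using \<alpha> F unfolding X.grothendieck_fibration_iff
    by (auto dest!: bspec[of _ _ ?F] bspec[of _ _ \<alpha>])
  have \<phi>: "\<phi> \<in> Arr (hom_E ?X)" using c by (rule X.cartesian_Arr)
  let ?H = "nt_src \<phi>"
  have H: "strict_morphism ?X (E, KE) ?H" using site_hom_ArrD(2)[OF \<phi>] .
  have n: "natural ?C E \<phi>" using site_hom_ArrD(1)[OF \<phi>] by simp
  note nD = naturalD(3-5)[OF n] and HD = is_functorD(2-4)[OF naturalD(1)[OF n]]
  have p: "on_ar P (component \<phi> x) = component \<alpha> x" if "x \<in> Obj ?C" for x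
    using arg_cong[OF p, of "\<lambda>\<beta>. component \<beta> x"] \<phi> that by simp
  let ?\<theta> = "component \<phi> apex" and ?h = "\<lambda>s. on_ar ?H (leg s)"
  have \<theta>: "?\<theta> \<in> Arr E" "src E ?\<theta> = on_ob ?H apex" "tgt E ?\<theta> = e"
    using nD[of apex] t by simp_all
  have "is_iso E ?\<theta>"
  proof (rule cartesian_over_iso)
    show "cartesian E B P ?\<theta>"
      by (rule internal_fibration_imp_pointwise_cartesian[OF internal is_site_cone c]) simp
    have "is_iso B (ident B (on_ob P e))"
      unfolding is_iso_def by (intro conjI bexI[of _ "ident B (on_ob P e)"]) simp_all
    then show "is_iso B (on_ar P ?\<theta>)" by (simp add: p)
  qed
  moreover have "?h ` S \<in> KE (src E ?\<theta>)"
  proof -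
    have "on_ar ?H ` leg ` S \<in> KE (on_ob ?H apex)"
      using H by (auto simp: strict_morphism_def cone_cov_def)
    then show ?thesis by (simp add: \<theta> image_image)
  qed
  moreover have "?h s \<in> Arr E \<and> tgt E (?h s) = src E ?\<theta> \<and> on_ar P (cmp E ?\<theta> (?h s)) = on_ar P s"
    if s: "s \<in> S" for s
  proof -
    \<comment> \<open>naturality at a leg, which the constant functor sends to an identity\<close>
    have "cmp E ?\<theta> (?h s) = cmp E (ident E e) (component \<phi> (base s))"
      using naturalD(6)[OF n, of "leg s"] s t by simp
    also have "\<dots> = component \<phi> (base s)"
      using nD[of "base s"] s t by simp
    finally show ?thesis
      using s HD[of "leg s"] \<theta>(2) p[of "base s"] by simp
  qed
  ultimately show ?thesis
    using that[of ?\<theta> ?h] \<theta>(3) by blast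
qed

text \<open>
  The axioms turn \<^term>\<open>{\<theta>}\<close> and the lifted covering of its source into a covering that
  refines the composites, and each composite factors through the member of \<^term>\<open>S\<close> that it lies over.
\<close>

lemma induced_covering_refined:
  assumes M': "axiom_M' E KE" and M: "axiom_M E KE" and L: "axiom_L E KE"
    and e: "e \<in> Obj E" and S: "S \<in> induced_covfun E B P KB e" "S \<noteq> {}"
  shows "\<exists>R\<in>KE e. refines E R S"
proof -
  obtain \<theta> h where \<theta>: "is_iso E \<theta>" "tgt E \<theta> = e" and h: "h ` S \<in> KE (src E \<theta>)"
    "\<And>s. s \<in> S \<Longrightarrow> h s \<in> Arr E \<and> tgt E (h s) = src E \<theta> \<and> on_ar P (cmp E \<theta> (h s)) = on_ar P s"
    using lift_of_induced_covering[OF M' e S] by blast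
  have \<theta>A: "\<theta> \<in> Arr E" using \<theta>(1) by (simp add: is_iso_def)
  let ?T = "{cmp E f g | f g. f \<in> {\<theta>} \<and> g \<in> h ` S}"
  have "{\<theta>} \<in> KE e" using M \<theta> by (auto simp: axiom_M_def)
  moreover have "\<forall>f\<in>{\<theta>}. h ` S \<in> KE (src E f)" using h(1) by simp
  ultimately obtain R where R: "R \<in> KE e" "refines E R ?T"
    using L[unfolded axiom_L_def, rule_format, of e "{\<theta>}" "\<lambda>_. h ` S"] e by blast
  have "refines E ?T S"
  proof (rule refines_of_cartesian)
    fix \<psi> assume "\<psi> \<in> ?T"
    then obtain s where s: "s \<in> S" "\<psi> = cmp E \<theta> (h s)" by blast
    then show "\<exists>\<phi>\<in>S. cartesian E B P \<phi> \<and> \<psi> \<in> Arr E \<and> tgt E \<psi> = tgt E \<phi> \<and> on_ar P \<psi> = on_ar P \<phi>"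
      using S(1) h(2)[OF s(1)] \<theta>A \<theta>(2) by (intro bexI[of _ s]) (auto simp: induced_covfun_def)
  qed
  moreover have "?T \<subseteq> Arr E" using h(2) \<theta>A by auto
  moreover have "S \<subseteq> Arr E" using S(1) cartesian_Arr by (auto simp: induced_covfun_def)
  ultimately have "refines E R S"
    using refines_trans[OF E.category_axioms _ R(2)] by blast
  then show ?thesis using R(1) by blast
qed

end

theorem proposition2p3p5:
  shows "(\<forall>(E :: ('u::infinite, 'u) category) (B :: ('u, 'u) category) P K.
           grothendieck_fibration E B P \<and> covering_function B K \<longrightarrow>
           internal_fibration SITEs (E, induced_covfun E B P K) (B, K) P) \<and>
         (\<forall>(E :: ('u, 'u) category) K\<^sub>E (B :: ('u, 'u) category) K\<^sub>B P.
           internal_fibration SITEs (E, K\<^sub>E) (B, K\<^sub>B) P \<and> axiom_M' B K\<^sub>B \<and> axiom_M' E K\<^sub>E \<longrightarrow>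
           grothendieck_fibration E B P \<and>
           (axiom_M E K\<^sub>E \<and> axiom_L E K\<^sub>E \<longrightarrow>
              cov_preceq E (\<lambda>e. induced_covfun E B P K\<^sub>B e - {{}}) K\<^sub>E \<and>
              ((\<forall>e\<in>Obj E. {} \<in> K\<^sub>B (on_ob P e) \<longrightarrow> {} \<in> K\<^sub>E e) \<longrightarrow>
                 cov_preceq E (induced_covfun E B P K\<^sub>B) K\<^sub>E)))"
proof (intro conjI allI impI; elim conjE)
  fix E B :: "('u, 'u) category" and P K
  assume fib: "grothendieck_fibration E B P" and K: "covering_function B K"
  then have F: "is_functor E B P" "category E" "category B"
    by (simp_all add: grothendieck_fibration_def)
  interpret category_over E B P
    using F by (intro category_over.intro category_over_axioms.intro)
  interpret site_over E B P "induced_covfun E B P K" K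
    using F K covering_function_induced strict_morphism_induced
    by unfold_locales (auto simp: is_site_def)
  show "internal_fibration SITEs (E, induced_covfun E B P K) (B, K) P"
    using internal_fibration_induced[OF fib] by simp
next
  fix E B :: "('u, 'u) category" and K\<^sub>E K\<^sub>B P
  assume i: "internal_fibration SITEs (E, K\<^sub>E) (B, K\<^sub>B) P" and M': "axiom_M' E K\<^sub>E"
  have s: "is_site (E, K\<^sub>E)" "is_site (B, K\<^sub>B)" "strict_morphism (E, K\<^sub>E) (B, K\<^sub>B) P"
    using i by (simp_all add: internal_fibration_def)
  interpret category_over E B P
    using site_categories[OF s(1)] site_categories[OF s(2)] strict_morphism_functor[OF s(3)]
    by (intro category_over.intro category_over_axioms.intro) simp_all
  interpret internal_fibration_of_sites E B P K\<^sub>E K\<^sub>B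
    using s i by unfold_locales
  show "grothendieck_fibration E B P"
    by (rule internal_fibration_imp_fibration[OF i])
  assume M: "axiom_M E K\<^sub>E" and L: "axiom_L E K\<^sub>E"
  note ref = induced_covering_refined[OF M' M L]
  show "cov_preceq E (\<lambda>e. induced_covfun E B P K\<^sub>B e - {{}}) K\<^sub>E"
    using ref by (auto simp: cov_preceq_def)
  assume empty: "\<forall>e\<in>Obj E. {} \<in> K\<^sub>B (on_ob P e) \<longrightarrow> {} \<in> K\<^sub>E e"
  \<comment> \<open>only the empty covering refines the empty covering\<close>
  have "\<exists>R\<in>K\<^sub>E e. refines E R {}" if "e \<in> Obj E" "{} \<in> induced_covfun E B P K\<^sub>B e" for e
    using empty that by (auto simp: induced_covfun_def refines_def)
  then show "cov_preceq E (induced_covfun E B P K\<^sub>B) K\<^sub>E"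
    using ref unfolding cov_preceq_def by metis
qed

end
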